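(* Let $\mu\in\mathbb R$, $\mathcal E_\mu=\mathcal E-\mu\mathbf 1$, and assume $\mathcal E_\mu>0$. Then the integral $$\int d\mu_{\mathbf V}(h)\int_{\mathbb C^{\mathbb X_T}}\mathcal Da\;e^{-(\bar a,\mathcal K(h)a)_{\mathbb X_T}}$$ is absolutely convergent. The grand-canonical covariance $\mathcal G(h)=\mathcal K(h)^{-1}$ exists for all real $h$, and its norm is bounded uniformly in $h$. It is analytic in $h$ on the set where $|\mathrm{Im}\,h_{j,x}|<\sqrt\epsilon\,e_{\min}$ for all $(j,x)$, where $e_{\min}$ is the smallest eigenvalue of $\mathcal E_\mu$. If $\mathcal E_\mu$ generates a stochastic process, then for all $j'\ge j$, all $x,x'\in\Lambda$ and all real $h$, $$\big|\mathcal G(h)_{(j,x),(j',x')}\big|\le\mathcal G(0)_{(j,x),(j',x')} .$$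
   Context: $\Lambda$ finite discrete torus $\mathbb Z^d/L\mathbb Z^d$ (spacing $1$, $(f,g)_\Lambda=\sum_xf_xg_x$); operators on $\mathbb C^\Lambda$ are matrices; functions on $\Lambda$ act as multiplication operators. $\mathcal E$ hermitian, $v$ real symmetric with $v\ge0$ (standing assumption). $\beta>0$, $n_\tau\in\mathbb N$, $\epsilon=\beta/n_\tau$, $\mathbb X_T=\{0,\dots,n_\tau\}\times\Lambda$, $a=(a_j)_{j=0}^{n_\tau}$, $a_j\in\mathbb C^\Lambda$, $\mathcal Da=\prod_{j,x}\frac{d\bar a_{j,x}\wedge da_{j,x}}{2\pi i}$. $h=(h_j)_{j=1}^{n_\tau}$, $h_j\in\mathbb R^\Lambda$ (complexified for the analyticity statement), $h_0=0$; $\mu_v$ the centered Gaussian probability measure on $\mathbb R^\Lambda$ with covariance $v$, $d\mu_{\mathbf V}(h)=\prod_{j=1}^{n_\tau}d\mu_v(h_j)$. $\mathcal K(h)$ is the block matrix indexed by $j,j'\in\{0,\dots,n_\tau\}$ with $\mathcal K(h)_{j,j'}=\delta_{j,j'}\mathbf 1-\delta_{j+1,j'}e^{-\epsilon\mathcal E_\mu}e^{i\sqrt\epsilon h_{j'}}-\delta_{j,n_\tau}\delta_{0,j'}\mathbf 1$, and $(\bar a,\mathcal K(h)a)_{\mathbb X_T}=\sum_{j,j'}(\bar a_j,\mathcal K(h)_{j,j'}a_{j'})_\Lambda$. An operator $T$ generates a stochastic process if $(e^{-\tau T})_{x,y}\ge0$ for all $\tau\ge0$, $x,y$. *)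

theory Defs
  imports "HOL-Probability.Probability"
begin

text \<open>Operators on C^Lambda, Lambda a finite index type 'x, are matrices 'x => 'x => complex.\<close>

type_synonym 'x cmat = "'x \<Rightarrow> 'x \<Rightarrow> complex"

definition mmult :: "('x::finite) cmat \<Rightarrow> 'x cmat \<Rightarrow> 'x cmat" where
  "mmult A B = (\<lambda>x y. \<Sum>z\<in>UNIV. A x z * B z y)"

definition mid :: "('x::finite) cmat" where
  "mid = (\<lambda>x y. if x = y then 1 else 0)"

definition mpow :: "('x::finite) cmat \<Rightarrow> nat \<Rightarrow> 'x cmat" where
  "mpow A k = ((mmult A) ^^ k) mid"

definition mexp :: "('x::finite) cmat \<Rightarrow> 'x cmat" where
  "mexp A = (\<lambda>x y. \<Sum>k. mpow A k x y / of_nat (fact k))"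

definition mscale :: "complex \<Rightarrow> ('x::finite) cmat \<Rightarrow> 'x cmat" where
  "mscale c A = (\<lambda>x y. c * A x y)"

definition hermitian :: "('x::finite) cmat \<Rightarrow> bool" where
  "hermitian A \<longleftrightarrow> (\<forall>x y. A x y = cnj (A y x))"

definition Emu :: "('x::finite) cmat \<Rightarrow> real \<Rightarrow> 'x cmat" where
  "Emu E mu = (\<lambda>x y. E x y - (if x = y then complex_of_real mu else 0))"

text \<open>A > 0 (positive definite, for hermitian A the quadratic form is real).\<close>
definition pos_def :: "('x::finite) cmat \<Rightarrow> bool" where
  "pos_def A \<longleftrightarrow> hermitian A \<and>
     (\<forall>f::'x \<Rightarrow> complex. f \<noteq> (\<lambda>_. 0) \<longrightarrow> 0 < Re (\<Sum>x\<in>UNIV. \<Sum>y\<in>UNIV. cnj (f x) * A x y * f y))"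

definition is_eigenvalue :: "('x::finite) cmat \<Rightarrow> complex \<Rightarrow> bool" where
  "is_eigenvalue A l \<longleftrightarrow> (\<exists>f::'x \<Rightarrow> complex. f \<noteq> (\<lambda>_. 0) \<and> (\<forall>x. (\<Sum>y\<in>UNIV. A x y * f y) = l * f x))"

text \<open>Smallest eigenvalue of a hermitian matrix (all eigenvalues are real).\<close>
definition e_min :: "('x::finite) cmat \<Rightarrow> real" where
  "e_min A = Min {r::real. is_eigenvalue A (complex_of_real r)}"

definition generates_stochastic :: "('x::finite) cmat \<Rightarrow> bool" where
  "generates_stochastic T \<longleftrightarrow>
     (\<forall>\<tau>::real. \<tau> \<ge> 0 \<longrightarrow> (\<forall>x y. mexp (mscale (- complex_of_real \<tau>) T) x y \<in> \<real>
                                    \<and> 0 \<le> Re (mexp (mscale (- complex_of_real \<tau>) T) x y)))"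

text \<open>Centered Gaussian probability measure on R^Lambda with covariance v,
  characterised by its characteristic function (allows degenerate v).\<close>
definition centered_gaussian :: "('x::finite \<Rightarrow> 'x \<Rightarrow> real) \<Rightarrow> ('x \<Rightarrow> real) measure \<Rightarrow> bool" where
  "centered_gaussian v M \<longleftrightarrow> prob_space M \<and> sets M = sets (PiM UNIV (\<lambda>_. borel)) \<and>
     (\<forall>\<xi>::'x \<Rightarrow> real. (\<integral>h. exp (\<i> * complex_of_real (\<Sum>x\<in>UNIV. \<xi> x * h x)) \<partial>M)
          = exp (- complex_of_real ((\<Sum>x\<in>UNIV. \<Sum>y\<in>UNIV. \<xi> x * v x y * \<xi> y) / 2)))"

definition XT :: "nat \<Rightarrow> (nat \<times> ('x::finite)) set" where
  "XT n\<tau> = {0..n\<tau>} \<times> UNIV"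

text \<open>The block matrix K(h), for complex h = (h_j)_{j=1..n_tau}, h_j in C^Lambda;
  here Emuv stands for E_mu and eps for epsilon.\<close>
definition Kmat :: "nat \<Rightarrow> real \<Rightarrow> ('x::finite) cmat \<Rightarrow> (nat \<Rightarrow> 'x \<Rightarrow> complex)
                     \<Rightarrow> (nat \<times> 'x) \<Rightarrow> (nat \<times> 'x) \<Rightarrow> complex" where
  "Kmat n\<tau> eps Emuv h = (\<lambda>(j, x) (j', x').
      (if j = j' \<and> x = x' then 1 else 0)
    - (if j' = j + 1 then mexp (mscale (- complex_of_real eps) Emuv) x x'
                          * exp (\<i> * complex_of_real (sqrt eps) * h j' x') else 0)
    - (if j = n\<tau> \<and> j' = 0 \<and> x = x' then 1 else 0))"

definition quadform :: "'p set \<Rightarrow> ('p \<Rightarrow> 'p \<Rightarrow> complex) \<Rightarrow> ('p \<Rightarrow> complex) \<Rightarrow> complex" where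
  "quadform S M a = (\<Sum>p\<in>S. \<Sum>q\<in>S. cnj (a p) * M p q * a q)"

definition inverse_on :: "'p set \<Rightarrow> ('p \<Rightarrow> 'p \<Rightarrow> complex) \<Rightarrow> ('p \<Rightarrow> 'p \<Rightarrow> complex) \<Rightarrow> bool" where
  "inverse_on S M N \<longleftrightarrow>
     (\<forall>p\<in>S. \<forall>q\<in>S. (\<Sum>r\<in>S. M p r * N r q) = (if p = q then 1 else 0)) \<and>
     (\<forall>p\<in>S. \<forall>q\<in>S. (\<Sum>r\<in>S. N p r * M r q) = (if p = q then 1 else 0)) \<and>
     (\<forall>p q. p \<notin> S \<or> q \<notin> S \<longrightarrow> N p q = 0)"

definition invertible_on :: "'p set \<Rightarrow> ('p \<Rightarrow> 'p \<Rightarrow> complex) \<Rightarrow> bool" where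
  "invertible_on S M \<longleftrightarrow> (\<exists>N. inverse_on S M N)"

definition inv_on :: "'p set \<Rightarrow> ('p \<Rightarrow> 'p \<Rightarrow> complex) \<Rightarrow> ('p \<Rightarrow> 'p \<Rightarrow> complex)" where
  "inv_on S M = (THE N. inverse_on S M N)"

definition Gcov :: "nat \<Rightarrow> real \<Rightarrow> ('x::finite) cmat \<Rightarrow> (nat \<Rightarrow> 'x \<Rightarrow> complex)
                     \<Rightarrow> (nat \<times> 'x) \<Rightarrow> (nat \<times> 'x) \<Rightarrow> complex" where
  "Gcov n\<tau> eps Emuv h = inv_on (XT n\<tau>) (Kmat n\<tau> eps Emuv h)"

definition opnorm_on :: "'p set \<Rightarrow> ('p \<Rightarrow> 'p \<Rightarrow> complex) \<Rightarrow> real" where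
  "opnorm_on S M = Sup {sqrt (\<Sum>p\<in>S. (cmod (\<Sum>q\<in>S. M p q * f q))\<^sup>2) | f.
                         (\<Sum>q\<in>S. (cmod (f q))\<^sup>2) \<le> 1}"

text \<open>Analyticity in the finitely many complex variables h_{j,x}, (j,x) in I, on D
  (Osgood: continuous and holomorphic in each variable separately).\<close>
definition analytic_several :: "(nat \<times> 'x) set \<Rightarrow> (nat \<Rightarrow> 'x \<Rightarrow> complex) set
                                 \<Rightarrow> ((nat \<Rightarrow> 'x \<Rightarrow> complex) \<Rightarrow> complex) \<Rightarrow> bool" where
  "analytic_several I D F \<longleftrightarrow> continuous_on D F \<and>
     (\<forall>h\<in>D. \<forall>(j, x)\<in>I. (\<lambda>z. F (h(j := (h j)(x := z))))
                          holomorphic_on {z. h(j := (h j)(x := z)) \<in> D})"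

text \<open>The measure Da = prod_{j,x} d abar d a / (2 pi i) = prod (d Re a d Im a / pi).\<close>
definition Da :: "nat \<Rightarrow> (nat \<times> ('x::finite) \<Rightarrow> complex) measure" where
  "Da n\<tau> = PiM (XT n\<tau>) (\<lambda>_. density lborel (\<lambda>_. ennreal (1 / pi)))"

end

theory Submission
  imports Defs
begin

text \<open>
  Write \<open>A = \<E>\<^sub>\<mu>\<close> and \<open>K(h) = 1 - N(h)\<close>. The Rayleigh quotient of \<open>A\<close> is at least \<open>e_min A\<close>, so the
  flow \<open>u' = - A u\<close> gives \<open>\<parallel>exp (- \<epsilon> A)\<parallel> \<le> exp (- \<epsilon> e_min A)\<close>. Hence on \<open>|Im h| \<le> c\<close> with
  \<open>c < \<surd>\<epsilon> e_min A\<close> each of the \<open>n\<close> forward blocks of \<open>N(h)\<close> has norm at most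
  \<open>r = exp (\<surd>\<epsilon> c - \<epsilon> e_min A) < 1\<close>; only the block closing the time circle has norm 1. AM-GM around
  the circle then yields the coercivity estimate \<open>Re (a, K(h) a) \<ge> (1 - r)/2 |a|\<^sup>2\<close>, from which all
  claims follow. It dominates the integrand by a Gaussian; it makes \<open>K(h)\<close> invertible with
  \<open>\<parallel>G(h)\<parallel> \<le> 2/(1 - r)\<close>; being stable under perturbation it lets the resolvent identity transfer
  analyticity from \<open>K\<close> to \<open>G\<close>. If \<open>A\<close> generates a stochastic process, then \<open>|N(h)| \<le> N(0)\<close>
  entrywise for real \<open>h\<close>, so the columns of \<open>|G(h)| - G(0)\<close> are subsolutions \<open>u \<le> N(0) u\<close>. The positive
  part of \<open>u\<close> is then a subsolution as well, and testing coercivity of \<open>K(0)\<close> with it gives \<open>u \<le> 0\<close>.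
\<close>

section \<open>Self-adjoint operators\<close>

definition selfadjoint :: "('a::real_inner \<Rightarrow> 'a) \<Rightarrow> bool" where
  "selfadjoint T \<longleftrightarrow> linear T \<and> (\<forall>x y. T x \<bullet> y = x \<bullet> T y)"

lemma selfadjoint_linear: "selfadjoint T \<Longrightarrow> linear T"
  by (simp add: selfadjoint_def)

lemma selfadjoint_inner: "selfadjoint T \<Longrightarrow> T x \<bullet> y = x \<bullet> T y"
  by (simp add: selfadjoint_def)

lemma selfadjoint_diff_scaleR:
  assumes "selfadjoint T"
  shows "selfadjoint (\<lambda>x. T x - l *\<^sub>R x)"
  using assms unfolding selfadjoint_def
  by (auto simp: inner_diff_left inner_diff_right
      intro: linear_compose_sub linear_scale_self)

lemma selfadjoint_quadratic_expand:
  assumes "selfadjoint T"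
  shows "(x + s *\<^sub>R y) \<bullet> T (x + s *\<^sub>R y) = x \<bullet> T x + 2 * s * (y \<bullet> T x) + s\<^sup>2 * (y \<bullet> T y)"
proof -
  have "x \<bullet> T y = y \<bullet> T x"
    using selfadjoint_inner[OF assms, of x y] by (simp add: inner_commute)
  then show ?thesis
    by (simp add: linear_add[OF selfadjoint_linear[OF assms]]
        linear_scale[OF selfadjoint_linear[OF assms]] inner_add_left inner_add_right
        power2_eq_square distrib_left)
qed

lemma selfadjoint_nonneg_kernel:
  assumes T: "selfadjoint T" and nonneg: "\<And>y. 0 \<le> y \<bullet> T y" and null: "x \<bullet> T x = 0"
  shows "T x = 0"
proof -
  let ?q = "\<lambda>s. (x + s *\<^sub>R T x) \<bullet> T (x + s *\<^sub>R T x)"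
  have "(?q has_real_derivative 2 * (T x \<bullet> T x)) (at 0)"
    unfolding selfadjoint_quadratic_expand[OF T] by (auto intro!: derivative_eq_intros)
  moreover have "\<forall>s. \<bar>0 - s\<bar> < 1 \<longrightarrow> ?q 0 \<le> ?q s"
    using nonneg null by simp
  ultimately have "2 * (T x \<bullet> T x) = 0"
    by (rule DERIV_local_min[OF _ zero_less_one])
  then show ?thesis by simp
qed

lemma selfadjoint_least_eigenvalue:
  fixes T :: "'a::euclidean_space \<Rightarrow> 'a"
  assumes T: "selfadjoint T"
  obtains l x where "x \<noteq> 0" "T x = l *\<^sub>R x" "\<And>y. l * (y \<bullet> y) \<le> y \<bullet> T y"
proof -
  let ?S = "sphere (0::'a) 1"
  have "continuous_on ?S (\<lambda>y. y \<bullet> T y)"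
    using selfadjoint_linear[OF T]
    by (intro continuous_on_inner continuous_on_id linear_continuous_on)
       (simp add: linear_conv_bounded_linear)
  moreover have "(SOME b. b \<in> Basis) \<in> ?S"
    by (simp add: SOME_Basis)
  ultimately obtain x where x: "x \<in> ?S" and min: "\<forall>y\<in>?S. x \<bullet> T x \<le> y \<bullet> T y"
    using continuous_attains_inf[OF compact_sphere, of 0 1 "\<lambda>y. y \<bullet> T y"] by blast
  define l where "l = x \<bullet> T x"
  have Rayleigh: "l * (y \<bullet> y) \<le> y \<bullet> T y" for y
  proof (cases "y = 0")
    case False
    have "l \<le> (y /\<^sub>R norm y) \<bullet> T (y /\<^sub>R norm y)"
      unfolding l_def using False by (intro min[rule_format]) simp
    also have "\<dots> = (y \<bullet> T y) / (y \<bullet> y)"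
      by (simp add: linear_scale[OF selfadjoint_linear[OF T]] dot_square_norm power2_eq_square
          divide_simps)
    finally show ?thesis using False by (simp add: field_simps)
  qed simp
  have "T x - l *\<^sub>R x = 0"
  proof (rule selfadjoint_nonneg_kernel[OF selfadjoint_diff_scaleR[OF T]])
    show "0 \<le> y \<bullet> (T y - l *\<^sub>R y)" for y
      using Rayleigh[of y] by (simp add: inner_diff_right)
    show "x \<bullet> (T x - l *\<^sub>R x) = 0"
      using x by (simp add: inner_diff_right l_def dot_square_norm)
  qed
  moreover have "x \<noteq> 0" using x by auto
  ultimately show thesis using that Rayleigh by simp
qed

lemma selfadjoint_eigenvectors_orthogonal:
  assumes "selfadjoint T" "T x = l *\<^sub>R x" "T y = m *\<^sub>R y" "l \<noteq> m"
  shows "orthogonal x y"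
proof -
  have "l * (x \<bullet> y) = m * (x \<bullet> y)"
    using selfadjoint_inner[OF assms(1), of x y] assms(2,3) by simp
  with \<open>l \<noteq> m\<close> show ?thesis by (simp add: orthogonal_def)
qed

lemma finite_eigenvalues_selfadjoint:
  fixes T :: "'a::euclidean_space \<Rightarrow> 'a"
  assumes T: "selfadjoint T"
  shows "finite {l. \<exists>x. x \<noteq> 0 \<and> T x = l *\<^sub>R x}" (is "finite ?L")
proof -
  obtain x where x: "\<And>l. l \<in> ?L \<Longrightarrow> x l \<noteq> 0 \<and> T (x l) = l *\<^sub>R x l"
    using bchoice[of ?L "\<lambda>l x. x \<noteq> 0 \<and> T x = l *\<^sub>R x"] by blast
  then have orth: "orthogonal (x l) (x m)" if "l \<in> ?L" "m \<in> ?L" "l \<noteq> m" for l m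
    using selfadjoint_eigenvectors_orthogonal[OF T] that by blast
  then have "pairwise orthogonal (x ` ?L)"
    unfolding pairwise_def by blast
  moreover have "inj_on x ?L"
    using orth x by (metis (no_types, lifting) inj_onI orthogonal_self)
  ultimately show ?thesis
    using pairwise_orthogonal_imp_finite finite_image_iff by blast
qed

section \<open>Complex matrices and the smallest eigenvalue\<close>

definition to_matrix :: "('x::finite) cmat \<Rightarrow> complex^'x^'x" where
  "to_matrix A = (\<chi> x y. A x y)"

lemma to_matrix_mult_nth [simp]: "(to_matrix A *v f) $ x = (\<Sum>y\<in>UNIV. A x y * f $ y)"
  by (simp add: to_matrix_def matrix_vector_mult_def)

lemma inner_complex_vec: "f \<bullet> g = Re (\<Sum>x\<in>UNIV. cnj (f $ x) * g $ x)" for f g :: "complex^'x"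
  by (simp add: inner_vec_def inner_complex_def)

lemma inner_to_matrix_mult:
  "f \<bullet> (to_matrix A *v g) = Re (\<Sum>x\<in>UNIV. \<Sum>y\<in>UNIV. cnj (f $ x) * A x y * g $ y)"
  by (simp add: inner_complex_vec sum_distrib_left mult.assoc)

lemma hermitian_imp_selfadjoint:
  assumes "hermitian A"
  shows "selfadjoint ((*v) (to_matrix A))"
  unfolding selfadjoint_def
proof (intro conjI allI)
  show "linear ((*v) (to_matrix A))"
    using matrix_vector_mul_bounded_linear by (rule bounded_linear.linear)
  have cnj_A: "cnj (A x y) = A y x" for x y
    using assms unfolding hermitian_def by metis
  fix f g
  have "(to_matrix A *v f) \<bullet> g = Re (\<Sum>y\<in>UNIV. \<Sum>x\<in>UNIV. cnj (f $ x) * A x y * g $ y)"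
    by (simp add: inner_complex_vec sum_distrib_left sum_distrib_right cnj_A mult_ac)
  also have "\<dots> = f \<bullet> (to_matrix A *v g)"
    unfolding inner_to_matrix_mult by (subst sum.swap) simp
  finally show "(to_matrix A *v f) \<bullet> g = f \<bullet> (to_matrix A *v g)" .
qed

lemma is_eigenvalue_of_real_iff:
  "is_eigenvalue A (complex_of_real l) \<longleftrightarrow> (\<exists>f. f \<noteq> 0 \<and> to_matrix A *v f = l *\<^sub>R f)"
proof
  assume "is_eigenvalue A (complex_of_real l)"
  then obtain f where "f \<noteq> (\<lambda>_. 0)" "\<forall>x. (\<Sum>y\<in>UNIV. A x y * f y) = complex_of_real l * f x"
    by (auto simp: is_eigenvalue_def)
  then have "vec_lambda f \<noteq> 0 \<and> to_matrix A *v vec_lambda f = l *\<^sub>R vec_lambda f"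
    by (auto simp: vec_eq_iff fun_eq_iff scaleR_conv_of_real[where 'a = complex])
  then show "\<exists>f. f \<noteq> 0 \<and> to_matrix A *v f = l *\<^sub>R f" by blast
next
  assume "\<exists>f. f \<noteq> 0 \<and> to_matrix A *v f = l *\<^sub>R f"
  then obtain f where "f \<noteq> 0" "to_matrix A *v f = l *\<^sub>R f" by blast
  then have "($) f \<noteq> (\<lambda>_. 0)" "\<forall>x. (\<Sum>y\<in>UNIV. A x y * f $ y) = complex_of_real l * f $ x"
    by (auto simp: vec_eq_iff fun_eq_iff scaleR_conv_of_real[where 'a = complex])
  then show "is_eigenvalue A (complex_of_real l)"
    unfolding is_eigenvalue_def by blast
qed

lemma
  assumes "hermitian A"
  shows e_min_le_Rayleigh: "e_min A * (g \<bullet> g) \<le> g \<bullet> (to_matrix A *v g)"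
    and is_eigenvalue_e_min: "is_eigenvalue A (complex_of_real (e_min A))"
proof -
  note T = hermitian_imp_selfadjoint[OF assms]
  obtain l f where eigen: "f \<noteq> 0" "to_matrix A *v f = l *\<^sub>R f"
    and Rayleigh: "\<And>g. l * (g \<bullet> g) \<le> g \<bullet> (to_matrix A *v g)"
    using selfadjoint_least_eigenvalue[OF T] by blast
  have "l \<le> m" if m: "is_eigenvalue A (complex_of_real m)" for m
  proof -
    obtain g where "g \<noteq> 0" "to_matrix A *v g = m *\<^sub>R g"
      using m is_eigenvalue_of_real_iff by blast
    then show ?thesis using Rayleigh[of g] by simp
  qed
  moreover have l: "is_eigenvalue A (complex_of_real l)"
    using eigen is_eigenvalue_of_real_iff by blast
  ultimately have "e_min A = l"
    unfolding e_min_def using finite_eigenvalues_selfadjoint[OF T]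
    by (intro Min_eqI) (auto simp: is_eigenvalue_of_real_iff)
  with Rayleigh l show "e_min A * (g \<bullet> g) \<le> g \<bullet> (to_matrix A *v g)"
    "is_eigenvalue A (complex_of_real (e_min A))" by auto
qed

lemma e_min_pos:
  assumes "pos_def A"
  shows "0 < e_min A"
proof -
  have "hermitian A" using assms by (simp add: pos_def_def)
  then obtain f where f: "f \<noteq> 0" "to_matrix A *v f = e_min A *\<^sub>R f"
    using is_eigenvalue_e_min is_eigenvalue_of_real_iff by blast
  then have "($) f \<noteq> (\<lambda>_. 0)" by (auto simp: vec_eq_iff fun_eq_iff)
  then have "0 < f \<bullet> (to_matrix A *v f)"
    using assms unfolding pos_def_def inner_to_matrix_mult by blast
  then have "0 < e_min A * (f \<bullet> f)" using f by simp
  moreover have "0 < f \<bullet> f" using f by simp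
  ultimately show ?thesis by (simp only: zero_less_mult_pos2)
qed

section \<open>Decay of the heat semigroup\<close>

lemma to_matrix_mid [simp]: "to_matrix mid = mat 1"
  by (simp add: to_matrix_def mid_def mat_def)

lemma to_matrix_mmult: "to_matrix (mmult A B) = to_matrix A ** to_matrix B"
  by (simp add: to_matrix_def mmult_def matrix_matrix_mult_def)

lemma mpow_0 [simp]: "mpow A 0 = mid"
  by (simp add: mpow_def)

lemma mpow_Suc: "mpow A (Suc k) x y = (\<Sum>z\<in>UNIV. A x z * mpow A k z y)"
  by (simp add: mpow_def mmult_def)

lemma mpow_mscale: "mpow (mscale c A) k x y = c ^ k * mpow A k x y"
  by (induction k arbitrary: x)
     (simp_all add: mpow_Suc mscale_def sum_distrib_left mult_ac)

lemma norm_mpow_le: "norm (mpow A k x y) \<le> (\<Sum>x\<in>UNIV. \<Sum>y\<in>UNIV. norm (A x y)) ^ k" (is "_ \<le> ?M ^ k")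
proof (induction k arbitrary: x)
  case 0
  then show ?case by (simp add: mid_def)
next
  case (Suc k)
  have "norm (mpow A (Suc k) x y) \<le> (\<Sum>z\<in>UNIV. norm (A x z) * ?M ^ k)"
    unfolding mpow_Suc using Suc
    by (intro order_trans[OF norm_sum] sum_mono) (simp add: norm_mult mult_left_mono)
  also have "\<dots> = (\<Sum>z\<in>UNIV. norm (A x z)) * ?M ^ k"
    by (simp add: sum_distrib_right)
  also have "\<dots> \<le> ?M * ?M ^ k"
    by (intro mult_right_mono zero_le_power sum_nonneg
        member_le_sum[where f = "\<lambda>x. \<Sum>y\<in>UNIV. norm (A x y)"]) (auto intro: sum_nonneg)
  finally show ?case by simp
qed

lemma summable_mexp_series: "summable (\<lambda>k. mpow A k x y / of_nat (fact k) * z ^ k)"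
proof (rule summable_comparison_test')
  let ?M = "\<Sum>x\<in>UNIV. \<Sum>y\<in>UNIV. norm (A x y)"
  show "summable (\<lambda>k. inverse (fact k) * (?M * norm z) ^ k)"
    by (rule summable_exp)
  show "norm (mpow A k x y / of_nat (fact k) * z ^ k) \<le> inverse (fact k) * (?M * norm z) ^ k" for k
    using norm_mpow_le[of A k x y]
    by (simp add: norm_mult norm_divide norm_power power_mult_distrib divide_simps mult_right_mono)
qed

lemma mexp_mscale: "mexp (mscale z A) x y = (\<Sum>k. mpow A k x y / of_nat (fact k) * z ^ k)"
  by (simp add: mexp_def mpow_mscale mult_ac)

lemma mexp_mscale_0 [simp]: "mexp (mscale 0 A) = mid"
  unfolding mexp_mscale fun_eq_iff by (intro allI, subst suminf_finite[of "{0}"]) auto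

lemma has_field_derivative_mexp_mscale:
  "((\<lambda>z. mexp (mscale z A) x y) has_field_derivative mmult A (mexp (mscale z A)) x y) (at z)"
proof -
  let ?c = "\<lambda>x k. mpow A k x y / of_nat (fact k)"
  have "((\<lambda>z. \<Sum>k. ?c x k * z ^ k) has_field_derivative (\<Sum>k. diffs (?c x) k * z ^ k)) (at z)"
    by (rule termdiffs_strong_converges_everywhere) (rule summable_mexp_series)
  moreover have "(\<Sum>k. diffs (?c x) k * z ^ k) = (\<Sum>k. \<Sum>w\<in>UNIV. A x w * (?c w k * z ^ k))"
  proof (intro suminf_cong)
    fix k
    have "diffs (?c x) k = mpow A (Suc k) x y / of_nat (fact k)"
      by (simp add: diffs_def divide_simps del: of_nat_Suc)
    then show "diffs (?c x) k * z ^ k = (\<Sum>w\<in>UNIV. A x w * (?c w k * z ^ k))"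
      by (simp add: mpow_Suc sum_divide_distrib sum_distrib_right mult.assoc)
  qed
  moreover have "\<dots> = (\<Sum>w\<in>UNIV. A x w * (\<Sum>k. ?c w k * z ^ k))"
    by (simp only: suminf_sum[OF summable_mult[OF summable_mexp_series]]
        suminf_mult[OF summable_mexp_series])
  ultimately show ?thesis by (simp add: mexp_mscale mmult_def)
qed

lemma norm_gradient_flow_le:
  fixes u :: "real \<Rightarrow> 'a::real_inner"
  assumes flow: "\<And>s. (u has_vector_derivative - T (u s)) (at s)"
    and lower: "\<And>y. c * (y \<bullet> y) \<le> y \<bullet> T y" and "0 \<le> t"
  shows "norm (u t) \<le> exp (- c * t) * norm (u 0)"
proof -
  define \<phi> where "\<phi> s = exp (2 * c * s) * (u s \<bullet> u s)" for s
  have deriv: "(\<phi> has_real_derivative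
      2 * exp (2 * c * s) * (c * (u s \<bullet> u s) - u s \<bullet> T (u s))) (at s)" for s
  proof -
    have "((\<lambda>s. u s \<bullet> u s) has_real_derivative - 2 * (u s \<bullet> T (u s))) (at s)"
      using has_derivative_inner[OF flow[of s, unfolded has_vector_derivative_def]
          flow[of s, unfolded has_vector_derivative_def]]
      unfolding has_field_derivative_def
      by (rule has_derivative_eq_rhs) (simp add: fun_eq_iff inner_commute)
    then have "(\<phi> has_real_derivative exp (2 * c * s) * (2 * c) * (u s \<bullet> u s)
        + - 2 * (u s \<bullet> T (u s)) * exp (2 * c * s)) (at s)"
      unfolding \<phi>_def by (intro DERIV_mult) (auto intro!: derivative_eq_intros)
    then show ?thesis
      by (rule DERIV_cong) (simp add: algebra_simps)
  qed
  have "\<phi> t \<le> \<phi> 0"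
  proof (rule DERIV_nonpos_imp_nonincreasing[OF \<open>0 \<le> t\<close>])
    show "\<exists>d. DERIV \<phi> s :> d \<and> d \<le> 0" for s
      using deriv[of s] lower[of "u s"] by (auto intro!: exI mult_nonneg_nonpos)
  qed
  then have "(exp (c * t) * norm (u t))\<^sup>2 \<le> (norm (u 0))\<^sup>2"
    by (simp add: \<phi>_def dot_square_norm power_mult_distrib exp_double[of "c * t"] mult.assoc)
  then have "exp (c * t) * norm (u t) \<le> norm (u 0)"
    by (rule power2_le_imp_le) simp
  then show ?thesis
    by (simp add: exp_minus field_simps)
qed

lemma has_vector_derivative_vec:
  fixes f :: "real \<Rightarrow> ('a::real_normed_vector)^'n"
  assumes "\<And>i. ((\<lambda>t. f t $ i) has_vector_derivative f' $ i) F"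
  shows "(f has_vector_derivative f') F"
proof -
  have axis: "bounded_linear (axis i :: 'a \<Rightarrow> 'a^'n)" for i
    by (rule bounded_linear_intro[where K = 1])
       (auto simp: vec_eq_iff axis_def norm_vec_def L2_set_def
         if_distrib[of norm] if_distrib[of "\<lambda>r. r\<^sup>2"] cong: if_cong)
  have decompose: "v = (\<Sum>i\<in>UNIV. axis i (v $ i))" for v :: "'a^'n"
    by (simp add: vec_eq_iff axis_def)
  have "((\<lambda>t. \<Sum>i\<in>UNIV. axis i (f t $ i)) has_vector_derivative (\<Sum>i\<in>UNIV. axis i (f' $ i))) F"
    by (intro has_vector_derivative_sum bounded_linear.has_vector_derivative[OF axis] assms)
  then show ?thesis by (simp only: decompose[symmetric])
qed

lemma has_vector_derivative_heat_flow:
  "((\<lambda>t. to_matrix (mexp (mscale (- complex_of_real t) A)) *v f) has_vector_derivative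
     - (to_matrix A *v (to_matrix (mexp (mscale (- complex_of_real t) A)) *v f))) (at t)"
proof (rule has_vector_derivative_vec)
  fix x
  let ?E = "\<lambda>t. mexp (mscale (- complex_of_real t) A)"
  have "((\<lambda>t. - complex_of_real t) has_vector_derivative - 1) (at t)"
    by (auto intro!: derivative_eq_intros)
  from field_vector_diff_chain_at[OF this has_field_derivative_mexp_mscale]
  have "((\<lambda>t. ?E t x y) has_vector_derivative - mmult A (?E t) x y) (at t)" for y
    by (simp add: o_def)
  then have "((\<lambda>t. \<Sum>y\<in>UNIV. ?E t x y * f $ y) has_vector_derivative
      (\<Sum>y\<in>UNIV. - mmult A (?E t) x y * f $ y)) (at t)"
    by (intro has_vector_derivative_sum has_vector_derivative_mult_left)
  then show "((\<lambda>t. (to_matrix (?E t) *v f) $ x) has_vector_derivative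
      (- (to_matrix A *v (to_matrix (?E t) *v f))) $ x) (at t)"
    by (simp add: matrix_vector_mul_assoc to_matrix_mmult[symmetric] sum_negf del: mult_minus_left)
qed

lemma norm_mexp_mult_le:
  assumes "hermitian A" "0 \<le> t"
  shows "norm (to_matrix (mexp (mscale (- complex_of_real t) A)) *v f)
    \<le> exp (- t * e_min A) * norm f"
  using norm_gradient_flow_le[OF has_vector_derivative_heat_flow
      e_min_le_Rayleigh[OF assms(1)] assms(2), of f]
  by (simp add: mult.commute)

section \<open>Coercive matrices over a finite index set\<close>

definition mulv_on :: "'p set \<Rightarrow> ('p \<Rightarrow> 'p \<Rightarrow> complex) \<Rightarrow> ('p \<Rightarrow> complex) \<Rightarrow> 'p \<Rightarrow> complex" where
  "mulv_on S M u = (\<lambda>p. \<Sum>q\<in>S. M p q * u q)"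

abbreviation norm_on :: "'p set \<Rightarrow> ('p \<Rightarrow> complex) \<Rightarrow> real" where
  "norm_on S u \<equiv> L2_set (\<lambda>p. cmod (u p)) S"

definition coercive_on :: "real \<Rightarrow> 'p set \<Rightarrow> ('p \<Rightarrow> 'p \<Rightarrow> complex) \<Rightarrow> bool" where
  "coercive_on \<kappa> S M \<longleftrightarrow> (\<forall>u. \<kappa> * (norm_on S u)\<^sup>2 \<le> Re (quadform S M u))"

lemma norm_on_power2: "(norm_on S u)\<^sup>2 = (\<Sum>p\<in>S. (cmod (u p))\<^sup>2)"
  by (simp add: L2_set_def sum_nonneg)

lemma quadform_eq_mulv_on: "quadform S M u = (\<Sum>p\<in>S. cnj (u p) * mulv_on S M u p)"
  by (simp add: quadform_def mulv_on_def sum_distrib_left mult.assoc)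

lemma mulv_on_add_scaled:
  "mulv_on S M (\<lambda>p. u p + z * w p) p = mulv_on S M u p + z * mulv_on S M w p"
  by (simp add: mulv_on_def distrib_left sum.distrib sum_distrib_left mult_ac)

lemma mulv_on_insert_update:
  assumes "finite S" "p \<notin> S"
  shows "mulv_on (insert p S) M (u(p := z)) r = M r p * z + mulv_on S M u r"
  using assms by (auto simp: mulv_on_def intro!: sum.cong)

lemma mulv_on_inverse_on:
  assumes "finite S" "inverse_on S M G" "p \<in> S"
  shows "mulv_on S M (mulv_on S G f) p = f p"
proof -
  have "mulv_on S M (mulv_on S G f) p = (\<Sum>r\<in>S. \<Sum>q\<in>S. M p r * G r q * f q)"
    by (simp add: mulv_on_def sum_distrib_left mult.assoc)
  also have "\<dots> = (\<Sum>q\<in>S. (\<Sum>r\<in>S. M p r * G r q) * f q)"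
    by (subst sum.swap) (simp add: sum_distrib_right)
  also have "\<dots> = (\<Sum>q\<in>S. if p = q then f q else 0)"
    using assms by (intro sum.cong) (auto simp: inverse_on_def)
  also have "\<dots> = f p" using assms by simp
  finally show ?thesis .
qed

lemma inverse_on_resolvent:
  assumes S: "finite S" "p \<in> S" "q \<in> S" and G: "inverse_on S M G" and G': "inverse_on S M' G'"
  shows "G p q - G' p q = (\<Sum>r\<in>S. \<Sum>s\<in>S. G p r * (M' r s - M r s) * G' s q)"
proof -
  have "(\<Sum>r\<in>S. \<Sum>s\<in>S. G p r * M' r s * G' s q) = (\<Sum>r\<in>S. G p r * (\<Sum>s\<in>S. M' r s * G' s q))"
    by (simp add: sum_distrib_left mult.assoc)
  also have "\<dots> = (\<Sum>r\<in>S. if r = q then G p r else 0)"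
    using S G' by (intro sum.cong) (auto simp: inverse_on_def)
  finally have G_M'_G': "(\<Sum>r\<in>S. \<Sum>s\<in>S. G p r * M' r s * G' s q) = G p q"
    using S by simp
  have "(\<Sum>r\<in>S. \<Sum>s\<in>S. G p r * M r s * G' s q) = (\<Sum>s\<in>S. (\<Sum>r\<in>S. G p r * M r s) * G' s q)"
    by (subst sum.swap) (simp add: sum_distrib_right)
  also have "\<dots> = (\<Sum>s\<in>S. if p = s then G' s q else 0)"
    using S G by (intro sum.cong) (auto simp: inverse_on_def)
  finally have G_M_G': "(\<Sum>r\<in>S. \<Sum>s\<in>S. G p r * M r s * G' s q) = G' p q"
    using S by simp
  show ?thesis
    by (simp add: G_M'_G' G_M_G' sum_subtractf right_diff_distrib left_diff_distrib)
qed

lemma inv_on_eqI: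
  assumes "finite S" and G: "inverse_on S M G"
  shows "inv_on S M = G"
  unfolding inv_on_def
proof (rule the_equality)
  show "inverse_on S M G" by (rule G)
next
  fix G' assume G': "inverse_on S M G'"
  have "G' p q = G p q" for p q
  proof (cases "p \<in> S \<and> q \<in> S")
    case True
    then show ?thesis using inverse_on_resolvent[OF \<open>finite S\<close> _ _ G' G, of p q] by simp
  next
    case False
    then show ?thesis using G G' unfolding inverse_on_def by metis
  qed
  then show "G' = G" by (intro ext)
qed

lemma opnorm_on_le:
  assumes "\<And>f. norm_on S f \<le> 1 \<Longrightarrow> norm_on S (mulv_on S M f) \<le> C"
  shows "opnorm_on S M \<le> C"
  unfolding opnorm_on_def
proof (rule cSup_least)
  show "{sqrt (\<Sum>p\<in>S. (cmod (\<Sum>q\<in>S. M p q * f q))\<^sup>2) | f. (\<Sum>q\<in>S. (cmod (f q))\<^sup>2) \<le> 1} \<noteq> {}"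
    by (auto intro!: exI[of _ "\<lambda>_. 0"])
qed (use assms in \<open>auto simp: L2_set_def mulv_on_def\<close>)

lemma coercive_on_norm_le:
  assumes "coercive_on \<kappa> S M"
  shows "\<kappa> * norm_on S u \<le> norm_on S (mulv_on S M u)"
proof (cases "norm_on S u = 0")
  case False
  have "\<kappa> * (norm_on S u)\<^sup>2 \<le> cmod (quadform S M u)"
    using assms complex_Re_le_cmod order_trans unfolding coercive_on_def by blast
  also have "\<dots> \<le> (\<Sum>p\<in>S. \<bar>cmod (u p)\<bar> * \<bar>cmod (mulv_on S M u p)\<bar>)"
    unfolding quadform_eq_mulv_on by (rule order_trans[OF norm_sum]) (simp add: norm_mult)
  also have "\<dots> \<le> norm_on S u * norm_on S (mulv_on S M u)"
    by (rule L2_set_mult_ineq)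
  finally have "norm_on S u * (\<kappa> * norm_on S u) \<le> norm_on S u * norm_on S (mulv_on S M u)"
    by (simp add: power2_eq_square mult_ac)
  moreover have "0 < norm_on S u"
    using False L2_set_nonneg[of "\<lambda>p. cmod (u p)" S] by linarith
  ultimately show ?thesis by (rule mult_left_le_imp_le)
qed simp

lemma coercive_on_kernel_trivial:
  assumes "finite S" "coercive_on \<kappa> S M" "0 < \<kappa>"
    and null: "\<And>p. p \<in> S \<Longrightarrow> mulv_on S M u p = 0" and "p \<in> S"
  shows "u p = 0"
proof -
  have "norm_on S (mulv_on S M u) = 0"
    using null by (simp add: L2_set_0')
  then have "norm_on S u \<le> 0"
    using coercive_on_norm_le[OF assms(2), of u] \<open>0 < \<kappa>\<close> by (simp add: mult_le_0_iff)
  then show ?thesis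
    using L2_set_eq_0_iff[OF \<open>finite S\<close>, of "\<lambda>p. cmod (u p)"] \<open>p \<in> S\<close> by (simp add: order_antisym)
qed

lemma coercive_on_subset:
  fixes M :: "'p \<Rightarrow> 'p \<Rightarrow> complex"
  assumes "finite S" "coercive_on \<kappa> S M" "T \<subseteq> S"
  shows "coercive_on \<kappa> T M"
  unfolding coercive_on_def
proof
  fix u :: "'p \<Rightarrow> complex"
  let ?u = "\<lambda>p. if p \<in> T then u p else 0"
  have "(norm_on S ?u)\<^sup>2 = (norm_on T u)\<^sup>2"
    unfolding norm_on_power2 using assms by (intro sum.mono_neutral_cong_right) auto
  moreover have "quadform S M ?u = quadform T M u"
    unfolding quadform_def
    using assms
    by (intro sum.mono_neutral_cong_right ballI) (auto intro!: sum.mono_neutral_cong_right)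
  ultimately show "\<kappa> * (norm_on T u)\<^sup>2 \<le> Re (quadform T M u)"
    using assms(2) unfolding coercive_on_def by metis
qed

lemma coercive_on_solvable:
  assumes "finite S" "coercive_on \<kappa> S M" "0 < \<kappa>"
  shows "\<exists>u. \<forall>p\<in>S. mulv_on S M u p = b p"
  using assms(1,2)
proof (induction S arbitrary: b rule: finite_induct)
  case (insert p S)
  have "coercive_on \<kappa> S M"
    using insert.hyps insert.prems by (blast intro: coercive_on_subset)
  note solvable = insert.IH[OF this]
  obtain u where u: "\<forall>r\<in>S. mulv_on S M u r = - M r p"
    using solvable[of "\<lambda>r. - M r p"] by blast
  obtain w where w: "\<forall>r\<in>S. mulv_on S M w r = b r"
    using solvable[of b] by blast
  note mulv_on_insert = mulv_on_insert_update[OF insert.hyps]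
  define \<alpha> where "\<alpha> = M p p + mulv_on S M u p"
  \<comment> \<open>The pivot of the last elimination step; if it vanished, \<open>u(p := 1)\<close> would be in the kernel.\<close>
  have "\<alpha> \<noteq> 0"
  proof
    assume "\<alpha> = 0"
    then have "mulv_on (insert p S) M (u(p := 1)) r = 0" if "r \<in> insert p S" for r
      using u that by (auto simp: mulv_on_insert \<alpha>_def)
    from coercive_on_kernel_trivial[OF _ insert.prems \<open>0 < \<kappa>\<close> this, of p] insert.hyps
    show False by simp
  qed
  then obtain z where z: "z * \<alpha> = b p - mulv_on S M w p"
    by (metis nonzero_divide_eq_eq)
  have value_eq: "mulv_on (insert p S) M ((\<lambda>r. w r + z * u r)(p := z)) r
      = mulv_on S M w r + z * (M r p + mulv_on S M u r)" for r
    by (simp add: mulv_on_insert mulv_on_add_scaled algebra_simps)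
  have "mulv_on (insert p S) M ((\<lambda>r. w r + z * u r)(p := z)) r = b r" if "r \<in> insert p S" for r
    using that
  proof
    assume "r = p"
    then show ?thesis using z by (simp add: value_eq \<alpha>_def)
  next
    assume "r \<in> S"
    then show ?thesis using u w by (simp add: value_eq)
  qed
  then show ?case by blast
qed simp

lemma inverse_on_inv_on:
  assumes S: "finite S" and coercive: "coercive_on \<kappa> S M" "0 < \<kappa>"
  shows "inverse_on S M (inv_on S M)"
proof -
  have "\<forall>q. \<exists>u. \<forall>p\<in>S. mulv_on S M u p = (if p = q then 1 else 0)"
    by (intro allI coercive_on_solvable[OF assms])
  from choice[OF this] obtain column
    where column: "\<And>q p. p \<in> S \<Longrightarrow> mulv_on S M (column q) p = (if p = q then 1 else 0)"
    by blast
  define G where "G p q = (if p \<in> S \<and> q \<in> S then column q p else 0)" for p q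
  have right: "(\<Sum>r\<in>S. M p r * G r q) = (if p = q then 1 else 0)" if "p \<in> S" "q \<in> S" for p q
    using column that by (simp add: G_def mulv_on_def)
  have "(\<Sum>r\<in>S. G p r * M r q) - (if p = q then 1 else 0) = 0" if "p \<in> S" "q \<in> S" for p q
  proof (rule coercive_on_kernel_trivial[OF assms _ \<open>p \<in> S\<close>])
    fix t assume "t \<in> S"
    have "mulv_on S M (\<lambda>p. (\<Sum>r\<in>S. G p r * M r q) - (if p = q then 1 else 0)) t
        = (\<Sum>p\<in>S. \<Sum>r\<in>S. M t p * G p r * M r q) - (\<Sum>p\<in>S. if p = q then M t p else 0)"
      unfolding mulv_on_def sum_subtractf[symmetric]
      by (intro sum.cong) (simp_all add: right_diff_distrib sum_distrib_left mult.assoc)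
    also have "\<dots> = (\<Sum>r\<in>S. (\<Sum>p\<in>S. M t p * G p r) * M r q) - M t q"
      using S \<open>q \<in> S\<close> by (subst sum.swap) (simp add: sum_distrib_right)
    also have "(\<Sum>r\<in>S. (\<Sum>p\<in>S. M t p * G p r) * M r q) = (\<Sum>r\<in>S. if t = r then M r q else 0)"
      using \<open>t \<in> S\<close> by (intro sum.cong) (simp_all add: right)
    finally show "mulv_on S M (\<lambda>p. (\<Sum>r\<in>S. G p r * M r q) - (if p = q then 1 else 0)) t = 0"
      using S \<open>t \<in> S\<close> by simp
  qed
  then have "inverse_on S M G"
    using right by (auto simp: inverse_on_def G_def)
  with inv_on_eqI[OF S this] show ?thesis by simp
qed

lemma opnorm_on_inv_on_le:
  assumes "finite S" "coercive_on \<kappa> S M" "0 < \<kappa>"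
  shows "opnorm_on S (inv_on S M) \<le> 1 / \<kappa>"
proof (rule opnorm_on_le)
  fix f assume f: "norm_on S f \<le> 1"
  have "\<kappa> * norm_on S (mulv_on S (inv_on S M) f)
      \<le> norm_on S (mulv_on S M (mulv_on S (inv_on S M) f))"
    by (rule coercive_on_norm_le[OF assms(2)])
  also have "\<dots> = norm_on S f"
    using mulv_on_inverse_on[OF \<open>finite S\<close> inverse_on_inv_on[OF assms]]
    by (intro L2_set_cong) auto
  finally show "norm_on S (mulv_on S (inv_on S M) f) \<le> 1 / \<kappa>"
    using f \<open>0 < \<kappa>\<close> by (simp add: field_simps)
qed

lemma cmod_inv_on_le:
  assumes "finite S" "coercive_on \<kappa> S M" "0 < \<kappa>" "p \<in> S" "q \<in> S"
  shows "cmod (inv_on S M p q) \<le> 1 / \<kappa>"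
proof -
  let ?g = "\<lambda>p. inv_on S M p q"
  have "mulv_on S M ?g r = (if r = q then 1 else 0)" if "r \<in> S" for r
    using inverse_on_inv_on[OF assms(1-3)] that \<open>q \<in> S\<close>
    by (simp add: inverse_on_def mulv_on_def)
  then have "norm_on S (mulv_on S M ?g) = L2_set (\<lambda>r. if r = q then 1 else 0) S"
    by (intro L2_set_cong) auto
  also have "\<dots> = 1"
    using assms by (simp add: L2_set_def if_distrib[of "\<lambda>r. r\<^sup>2"] cong: if_cong)
  finally have "\<kappa> * norm_on S ?g \<le> 1"
    using coercive_on_norm_le[OF assms(2), of ?g] by simp
  then have "norm_on S ?g \<le> 1 / \<kappa>"
    using \<open>0 < \<kappa>\<close> by (simp add: field_simps)
  with member_le_L2_set[OF assms(1,4), of "\<lambda>p. cmod (?g p)"] show ?thesis by simp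
qed

section \<open>Continuity and differentiability of the inverse\<close>

lemma coercive_on_perturb:
  fixes M :: "'p \<Rightarrow> 'p \<Rightarrow> complex"
  assumes "finite S" "coercive_on \<kappa> S M" and close: "(\<Sum>p\<in>S. \<Sum>q\<in>S. cmod (M' p q - M p q)) \<le> \<delta>"
  shows "coercive_on (\<kappa> - \<delta>) S M'"
  unfolding coercive_on_def
proof
  fix u :: "'p \<Rightarrow> complex"
  have cmod_u_le: "cmod (u p) \<le> norm_on S u" if "p \<in> S" for p
    using member_le_L2_set[OF \<open>finite S\<close> that, of "\<lambda>p. cmod (u p)"] .
  have "cmod (quadform S M' u - quadform S M u)
      = cmod (\<Sum>p\<in>S. \<Sum>q\<in>S. cnj (u p) * (M' p q - M p q) * u q)"
    by (simp add: quadform_def sum_subtractf right_diff_distrib left_diff_distrib)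
  also have "\<dots> \<le> (\<Sum>p\<in>S. \<Sum>q\<in>S. norm_on S u * cmod (M' p q - M p q) * norm_on S u)"
    by (intro sum_norm_le) (auto simp: norm_mult intro!: mult_mono cmod_u_le)
  also have "\<dots> = (\<Sum>p\<in>S. \<Sum>q\<in>S. cmod (M' p q - M p q)) * (norm_on S u)\<^sup>2"
    by (simp add: sum_distrib_left sum_distrib_right power2_eq_square mult_ac)
  also have "\<dots> \<le> \<delta> * (norm_on S u)\<^sup>2"
    using close by (intro mult_right_mono) auto
  finally have "Re (quadform S M u) - \<delta> * (norm_on S u)\<^sup>2 \<le> Re (quadform S M' u)"
    using abs_Re_le_cmod[of "quadform S M' u - quadform S M u"] by (simp add: abs_le_iff)
  moreover have "\<kappa> * (norm_on S u)\<^sup>2 \<le> Re (quadform S M u)"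
    using assms(2) by (simp add: coercive_on_def)
  ultimately show "(\<kappa> - \<delta>) * (norm_on S u)\<^sup>2 \<le> Re (quadform S M' u)"
    by (simp add: left_diff_distrib)
qed

lemma eventually_coercive_on:
  assumes "finite S" "coercive_on \<kappa> S M\<^sub>0" "0 < \<kappa>"
    and tendsto: "\<And>r s. r \<in> S \<Longrightarrow> s \<in> S \<Longrightarrow> ((\<lambda>h. M h r s) \<longlongrightarrow> M\<^sub>0 r s) F"
  shows "\<forall>\<^sub>F h in F. coercive_on (\<kappa> / 2) S (M h)"
proof -
  have "((\<lambda>h. \<Sum>r\<in>S. \<Sum>s\<in>S. cmod (M h r s - M\<^sub>0 r s)) \<longlongrightarrow> (\<Sum>r\<in>S. \<Sum>s\<in>S. cmod (M\<^sub>0 r s - M\<^sub>0 r s))) F"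
    by (intro tendsto_sum tendsto_norm tendsto_diff tendsto tendsto_const)
  then have "\<forall>\<^sub>F h in F. (\<Sum>r\<in>S. \<Sum>s\<in>S. cmod (M h r s - M\<^sub>0 r s)) < \<kappa> / 2"
    using \<open>0 < \<kappa>\<close> by (intro order_tendstoD(2)) auto
  then show ?thesis
  proof eventually_elim
    case (elim h)
    then show ?case
      using coercive_on_perturb[OF assms(1,2), of "M h" "\<kappa> / 2"] by simp
  qed
qed

lemma tendsto_inv_on:
  assumes S: "finite S" "p \<in> S" "q \<in> S" and coercive: "coercive_on \<kappa> S M\<^sub>0" "0 < \<kappa>"
    and tendsto: "\<And>r s. r \<in> S \<Longrightarrow> s \<in> S \<Longrightarrow> ((\<lambda>h. M h r s) \<longlongrightarrow> M\<^sub>0 r s) F"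
  shows "((\<lambda>h. inv_on S (M h) p q) \<longlongrightarrow> inv_on S M\<^sub>0 p q) F"
proof -
  let ?bound = "\<lambda>h. \<Sum>r\<in>S. \<Sum>s\<in>S. 2 / \<kappa> * cmod (M\<^sub>0 r s - M h r s) * cmod (inv_on S M\<^sub>0 s q)"
  have "(?bound \<longlongrightarrow> (\<Sum>r\<in>S. \<Sum>s\<in>S. 2 / \<kappa> * cmod (M\<^sub>0 r s - M\<^sub>0 r s) * cmod (inv_on S M\<^sub>0 s q))) F"
    by (intro tendsto_sum tendsto_mult tendsto_norm tendsto_diff tendsto tendsto_const)
  then have bound: "(?bound \<longlongrightarrow> 0) F" by simp
  have "\<forall>\<^sub>F h in F. coercive_on (\<kappa> / 2) S (M h)"
    by (rule eventually_coercive_on[OF S(1) coercive tendsto])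
  then have "\<forall>\<^sub>F h in F. cmod (inv_on S (M h) p q - inv_on S M\<^sub>0 p q) \<le> ?bound h"
  proof eventually_elim
    case (elim h)
    have "0 < \<kappa> / 2" using \<open>0 < \<kappa>\<close> by simp
    have "cmod (inv_on S (M h) p r) \<le> 2 / \<kappa>" if "r \<in> S" for r
      using cmod_inv_on_le[OF S(1) elim \<open>0 < \<kappa> / 2\<close> S(2) that] by simp
    then show ?case
      unfolding inverse_on_resolvent[OF S inverse_on_inv_on[OF S(1) elim \<open>0 < \<kappa> / 2\<close>]
          inverse_on_inv_on[OF S(1) coercive]]
      by (intro sum_norm_le) (auto simp only: norm_mult intro!: mult_right_mono norm_ge_zero)
  qed
  then have "((\<lambda>h. inv_on S (M h) p q - inv_on S M\<^sub>0 p q) \<longlongrightarrow> 0) F"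
    by (rule Lim_null_comparison[OF _ bound])
  then show ?thesis by (simp add: LIM_zero_iff)
qed

lemma has_field_derivative_inv_on:
  assumes S: "finite S" "p \<in> S" "q \<in> S" and coercive: "coercive_on \<kappa> S (M w)" "0 < \<kappa>"
    and deriv: "\<And>r s. r \<in> S \<Longrightarrow> s \<in> S \<Longrightarrow> ((\<lambda>z. M z r s) has_field_derivative M' r s) (at w within Z)"
  shows "((\<lambda>z. inv_on S (M z) p q) has_field_derivative
    (\<Sum>r\<in>S. \<Sum>s\<in>S. inv_on S (M w) p r * - M' r s * inv_on S (M w) s q)) (at w within Z)"
proof -
  let ?G = "\<lambda>z. inv_on S (M z)"
  have cont: "((\<lambda>z. M z r s) \<longlongrightarrow> M w r s) (at w within Z)" if "r \<in> S" "s \<in> S" for r s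
    using DERIV_continuous[OF deriv[OF that]] by (simp add: continuous_within)
  have quotient: "((\<lambda>z. (M w r s - M z r s) / (z - w)) \<longlongrightarrow> - M' r s) (at w within Z)"
    if "r \<in> S" "s \<in> S" for r s
    using tendsto_minus[OF deriv[OF that, unfolded has_field_derivative_iff]]
    by (simp add: minus_divide_left)
  have "((\<lambda>z. \<Sum>r\<in>S. \<Sum>s\<in>S. ?G z p r * ((M w r s - M z r s) / (z - w)) * ?G w s q) \<longlongrightarrow>
      (\<Sum>r\<in>S. \<Sum>s\<in>S. ?G w p r * - M' r s * ?G w s q)) (at w within Z)"
    using S
    by (intro tendsto_sum tendsto_mult tendsto_const quotient
        tendsto_inv_on[OF S(1) _ _ coercive cont])
  moreover have "\<forall>\<^sub>F z in at w within Z. coercive_on (\<kappa> / 2) S (M z)"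
    by (rule eventually_coercive_on[OF S(1) coercive cont])
  then have "\<forall>\<^sub>F z in at w within Z.
      (\<Sum>r\<in>S. \<Sum>s\<in>S. ?G z p r * ((M w r s - M z r s) / (z - w)) * ?G w s q)
      = (?G z p q - ?G w p q) / (z - w)"
  proof eventually_elim
    case (elim z)
    have "inverse_on S (M z) (?G z)"
      using inverse_on_inv_on[OF S(1) elim] \<open>0 < \<kappa>\<close> by simp
    from inverse_on_resolvent[OF S this inverse_on_inv_on[OF S(1) coercive]]
    show ?case by (simp add: sum_divide_distrib)
  qed
  ultimately show ?thesis
    unfolding has_field_derivative_iff by (rule Lim_transform_eventually)
qed

lemma continuous_on_inv_on:
  assumes S: "finite S" "p \<in> S" "q \<in> S"
    and coercive: "\<And>h. h \<in> D \<Longrightarrow> \<exists>\<kappa>>0. coercive_on \<kappa> S (M h)"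
    and cont: "\<And>r s. r \<in> S \<Longrightarrow> s \<in> S \<Longrightarrow> continuous_on D (\<lambda>h. M h r s)"
  shows "continuous_on D (\<lambda>h. inv_on S (M h) p q)"
  unfolding continuous_on_def
proof
  fix h assume "h \<in> D"
  with coercive obtain \<kappa> where "coercive_on \<kappa> S (M h)" "0 < \<kappa>" by blast
  then show "((\<lambda>h. inv_on S (M h) p q) \<longlongrightarrow> inv_on S (M h) p q) (at h within D)"
    using cont \<open>h \<in> D\<close> by (intro tendsto_inv_on[OF S]) (auto simp: continuous_on_def)
qed

lemma holomorphic_on_inv_on:
  assumes S: "finite S" "p \<in> S" "q \<in> S"
    and coercive: "\<And>z. z \<in> Z \<Longrightarrow> \<exists>\<kappa>>0. coercive_on \<kappa> S (M z)"
    and holo: "\<And>r s. r \<in> S \<Longrightarrow> s \<in> S \<Longrightarrow> (\<lambda>z. M z r s) holomorphic_on Z"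
  shows "(\<lambda>z. inv_on S (M z) p q) holomorphic_on Z"
  unfolding holomorphic_on_def
proof
  fix w assume w: "w \<in> Z"
  with coercive obtain \<kappa> where \<kappa>: "coercive_on \<kappa> S (M w)" "0 < \<kappa>" by blast
  have "\<exists>d. ((\<lambda>z. M z r s) has_field_derivative d) (at w within Z)" if "r \<in> S" "s \<in> S" for r s
    using holo[OF that] w unfolding holomorphic_on_def field_differentiable_def by blast
  then obtain M' where "\<And>r s. r \<in> S \<Longrightarrow> s \<in> S \<Longrightarrow>
      ((\<lambda>z. M z r s) has_field_derivative M' r s) (at w within Z)"
    by metis
  from has_field_derivative_inv_on[OF S \<kappa> this]
  show "(\<lambda>z. inv_on S (M z) p q) field_differentiable at w within Z"
    by (auto simp: field_differentiable_def)
qed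

lemma analytic_several_inv_on:
  assumes S: "finite S" "p \<in> S" "q \<in> S"
    and coercive: "\<And>h. h \<in> D \<Longrightarrow> \<exists>\<kappa>>0. coercive_on \<kappa> S (M h)"
    and analytic: "\<And>r s. r \<in> S \<Longrightarrow> s \<in> S \<Longrightarrow> analytic_several I D (\<lambda>h. M h r s)"
  shows "analytic_several I D (\<lambda>h. inv_on S (M h) p q)"
proof -
  have "continuous_on D (\<lambda>h. inv_on S (M h) p q)"
    using analytic by (intro continuous_on_inv_on[OF S coercive]) (auto simp: analytic_several_def)
  moreover have "(\<lambda>z. inv_on S (M (h(j := (h j)(x := z)))) p q)
      holomorphic_on {z. h(j := (h j)(x := z)) \<in> D}" if "h \<in> D" "(j, x) \<in> I" for h j x
    using that analytic
    by (intro holomorphic_on_inv_on[OF S] coercive) (fastforce simp: analytic_several_def)+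
  ultimately show ?thesis
    by (auto simp: analytic_several_def)
qed

section \<open>Domination of inverses\<close>

definition one_minus :: "('p \<Rightarrow> 'p \<Rightarrow> complex) \<Rightarrow> 'p \<Rightarrow> 'p \<Rightarrow> complex" where
  "one_minus N = (\<lambda>p q. (if p = q then 1 else 0) - N p q)"

lemma mulv_on_one_minus:
  assumes "finite S" "p \<in> S"
  shows "mulv_on S (one_minus N) u p = u p - mulv_on S N u p"
proof -
  have "mulv_on S (one_minus N) u p = (\<Sum>q\<in>S. if p = q then u q else 0) - mulv_on S N u p"
    unfolding mulv_on_def one_minus_def sum_subtractf[symmetric]
    by (intro sum.cong) (auto simp: left_diff_distrib)
  then show ?thesis using assms by simp
qed

lemma Re_quadform_one_minus:
  assumes "finite S"
  shows "Re (quadform S (one_minus N) u) = (norm_on S u)\<^sup>2 - Re (quadform S N u)"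
proof -
  have "quadform S (one_minus N) u = (\<Sum>p\<in>S. cnj (u p) * u p) - quadform S N u"
    using assms
    by (simp add: quadform_eq_mulv_on mulv_on_one_minus right_diff_distrib sum_subtractf)
  moreover have "Re (cnj z * z) = (cmod z)\<^sup>2" for z
    unfolding cmod_power2 by (simp add: power2_eq_square)
  ultimately show ?thesis by (simp add: norm_on_power2)
qed

lemma inv_on_one_minus_eq:
  assumes "finite S" "coercive_on \<kappa> S (one_minus N)" "0 < \<kappa>" "p \<in> S" "q \<in> S"
  shows "inv_on S (one_minus N) p q
    = (if p = q then 1 else 0) + (\<Sum>r\<in>S. N p r * inv_on S (one_minus N) r q)"
proof -
  have "mulv_on S (one_minus N) (\<lambda>r. inv_on S (one_minus N) r q) p = (if p = q then 1 else 0)"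
    using inverse_on_inv_on[OF assms(1-3)] assms(4,5)
    by (simp add: mulv_on_def inverse_on_def)
  then show ?thesis
    unfolding mulv_on_one_minus[OF assms(1,4)] by (simp add: mulv_on_def diff_eq_eq)
qed

lemma subsolution_nonpos:
  fixes R :: "'p \<Rightarrow> 'p \<Rightarrow> real" and u :: "'p \<Rightarrow> real"
  assumes S: "finite S"
    and coercive: "coercive_on \<kappa> S (one_minus (\<lambda>p q. complex_of_real (R p q)))" "0 < \<kappa>"
    and nonneg: "\<And>p q. p \<in> S \<Longrightarrow> q \<in> S \<Longrightarrow> 0 \<le> R p q"
    and subsolution: "\<And>p. p \<in> S \<Longrightarrow> u p \<le> (\<Sum>q\<in>S. R p q * u q)" and "p \<in> S"
  shows "u p \<le> 0"
proof -
  let ?R = "\<lambda>p q. complex_of_real (R p q)" and ?w = "\<lambda>p. max 0 (u p)"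
  have w_le: "?w p \<le> (\<Sum>q\<in>S. R p q * ?w q)" if "p \<in> S" for p
  proof (rule max.boundedI)
    show "0 \<le> (\<Sum>q\<in>S. R p q * ?w q)"
      using nonneg that by (intro sum_nonneg) simp
    have "(\<Sum>q\<in>S. R p q * u q) \<le> (\<Sum>q\<in>S. R p q * ?w q)"
      using nonneg that by (intro sum_mono mult_left_mono) auto
    with subsolution[OF that] show "u p \<le> (\<Sum>q\<in>S. R p q * ?w q)" by linarith
  qed
  have "Re (quadform S (one_minus ?R) ?w) = (\<Sum>p\<in>S. ?w p * (?w p - (\<Sum>q\<in>S. R p q * ?w q)))"
    using S by (simp add: quadform_eq_mulv_on mulv_on_one_minus) (simp add: mulv_on_def)
  also have "\<dots> \<le> 0"
    using w_le by (intro sum_nonpos mult_nonneg_nonpos) auto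
  finally have "\<kappa> * (norm_on S ?w)\<^sup>2 \<le> 0"
    using coercive(1) order_trans unfolding coercive_on_def by blast
  then have "norm_on S ?w = 0"
    using \<open>0 < \<kappa>\<close> by (simp add: mult_le_0_iff)
  then have "?w p = 0"
    using S \<open>p \<in> S\<close> by (simp add: L2_set_eq_0_iff)
  then show ?thesis by (simp add: max_def split: if_splits)
qed

lemma inv_on_one_minus_real:
  fixes R :: "'p \<Rightarrow> 'p \<Rightarrow> real"
  defines "M \<equiv> one_minus (\<lambda>p q. complex_of_real (R p q))"
  assumes S: "finite S" and coercive: "coercive_on \<kappa> S M" "0 < \<kappa>"
    and nonneg: "\<And>p q. p \<in> S \<Longrightarrow> q \<in> S \<Longrightarrow> 0 \<le> R p q" and pq: "p \<in> S" "q \<in> S"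
  shows "inv_on S M p q \<in> \<real>"
proof -
  let ?g = "\<lambda>r. inv_on S M r q"
  have Im_g_eq: "Im (?g r) = (\<Sum>s\<in>S. R r s * Im (?g s))" if "r \<in> S" for r
    unfolding M_def by (subst inv_on_one_minus_eq[OF S coercive[unfolded M_def] that pq(2)]) simp
  have "Im (?g p) \<le> 0"
    by (rule subsolution_nonpos[OF S coercive[unfolded M_def] nonneg _ pq(1)])
       (auto simp: Im_g_eq)
  moreover have "- Im (?g p) \<le> 0"
    by (rule subsolution_nonpos[OF S coercive[unfolded M_def] nonneg _ pq(1)])
       (auto simp: sum_negf Im_g_eq)
  ultimately show ?thesis
    by (simp add: complex_is_Real_iff)
qed

lemma cmod_inv_on_one_minus_le:
  fixes N :: "'p \<Rightarrow> 'p \<Rightarrow> complex" and R :: "'p \<Rightarrow> 'p \<Rightarrow> real"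
  defines "M \<equiv> one_minus N" and "M\<^sub>0 \<equiv> one_minus (\<lambda>p q. complex_of_real (R p q))"
  assumes S: "finite S"
    and coercive: "coercive_on \<kappa> S M" "0 < \<kappa>" and coercive\<^sub>0: "coercive_on \<kappa>\<^sub>0 S M\<^sub>0" "0 < \<kappa>\<^sub>0"
    and dominated: "\<And>p q. p \<in> S \<Longrightarrow> q \<in> S \<Longrightarrow> cmod (N p q) \<le> R p q" and pq: "p \<in> S" "q \<in> S"
  shows "cmod (inv_on S M p q) \<le> Re (inv_on S M\<^sub>0 p q)"
proof -
  let ?g = "\<lambda>r. inv_on S M r q" and ?g\<^sub>0 = "\<lambda>r. inv_on S M\<^sub>0 r q"
  have cmod_g_le: "cmod (?g r) \<le> (if r = q then 1 else 0) + (\<Sum>s\<in>S. R r s * cmod (?g s))"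
    if "r \<in> S" for r
  proof -
    have "?g r = (if r = q then 1 else 0) + (\<Sum>s\<in>S. N r s * ?g s)"
      unfolding M_def by (rule inv_on_one_minus_eq[OF S coercive[unfolded M_def] that pq(2)])
    also have "cmod \<dots> \<le> (if r = q then 1 else 0) + (\<Sum>s\<in>S. R r s * cmod (?g s))"
      using dominated[OF that]
      by (intro order_trans[OF norm_triangle_ineq] add_mono sum_norm_le)
         (auto simp: norm_mult mult_right_mono)
    finally show ?thesis .
  qed
  have Re_g\<^sub>0_eq: "Re (?g\<^sub>0 r) = (if r = q then 1 else 0) + (\<Sum>s\<in>S. R r s * Re (?g\<^sub>0 s))"
    if "r \<in> S" for r
    unfolding M\<^sub>0_def
    by (subst inv_on_one_minus_eq[OF S coercive\<^sub>0[unfolded M\<^sub>0_def] that pq(2)]) simp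
  have "cmod (?g p) - Re (?g\<^sub>0 p) \<le> 0"
  proof (rule subsolution_nonpos[OF S coercive\<^sub>0[unfolded M\<^sub>0_def] _ _ pq(1)])
    show "0 \<le> R r s" if "r \<in> S" "s \<in> S" for r s
      using dominated[OF that] norm_ge_zero order_trans by blast
    show "cmod (?g r) - Re (?g\<^sub>0 r) \<le> (\<Sum>s\<in>S. R r s * (cmod (?g s) - Re (?g\<^sub>0 s)))" if "r \<in> S" for r
      unfolding Re_g\<^sub>0_eq[OF that] using cmod_g_le[OF that]
      by (simp add: right_diff_distrib sum_subtractf)
  qed
  then show ?thesis by simp
qed

section \<open>Gaussian integrals\<close>

lemma integrable_exp_neg_norm_power2:
  assumes "0 < c"
  shows "integrable lborel (\<lambda>x::'a::euclidean_space. exp (- c * (norm x)\<^sup>2))"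
proof -
  define \<sigma> where "\<sigma> = sqrt (1 / (2 * c))"
  have \<sigma>: "\<sigma>\<^sup>2 = 1 / (2 * c)" "0 < \<sigma>" using assms by (auto simp: \<sigma>_def)
  have "exp (- c * t\<^sup>2) = sqrt (2 * pi * \<sigma>\<^sup>2) * normal_density 0 \<sigma> t" for t
    using assms \<sigma> by (simp add: normal_density_def)
  then have "integrable lborel (\<lambda>t. exp (- c * t\<^sup>2))"
    using \<sigma> by simp
  then have one_dim: "(\<integral>\<^sup>+t. ennreal (exp (- c * t\<^sup>2)) \<partial>lborel) < \<infinity>"
    by (simp add: integrable_iff_bounded)
  have "(norm x)\<^sup>2 = (\<Sum>b\<in>Basis. (x \<bullet> b)\<^sup>2)" for x :: 'a
    by (simp add: norm_eq_sqrt_inner euclidean_inner[of x x] power2_eq_square[symmetric] sum_nonneg)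
  then have "(\<integral>\<^sup>+x. ennreal (exp (- c * (norm (x::'a))\<^sup>2)) \<partial>lborel)
      = (\<integral>\<^sup>+x. (\<Prod>b\<in>(Basis::'a set). ennreal (exp (- c * (x \<bullet> b)\<^sup>2))) \<partial>lborel)"
    by (simp add: prod_ennreal exp_sum[symmetric] sum_distrib_left sum_negf)
  also have "\<dots> = (\<Prod>b\<in>(Basis::'a set). \<integral>\<^sup>+t. ennreal (exp (- c * t\<^sup>2)) \<partial>lborel)"
    by (rule nn_integral_lborel_prod) auto
  also have "\<dots> < \<infinity>"
    using one_dim by (simp add: power_less_top_ennreal)
  finally show ?thesis by (simp add: integrable_iff_bounded)
qed

lemma borel_measurable_exp_neg_quadform:
  assumes \<nu>: "sets \<nu> = sets borel"
    and M: "\<And>p q. p \<in> S \<Longrightarrow> q \<in> S \<Longrightarrow> (\<lambda>h. M h p q) \<in> borel_measurable H"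
  shows "(\<lambda>(h, a). exp (- quadform S (M h) a)) \<in> borel_measurable (H \<Otimes>\<^sub>M PiM S (\<lambda>_. \<nu>))"
proof -
  let ?P = "H \<Otimes>\<^sub>M PiM S (\<lambda>_. \<nu>)"
  have "(\<lambda>\<omega>. snd \<omega> p) \<in> measurable ?P \<nu>" if "p \<in> S" for p
    using that by (intro measurable_compose[OF measurable_snd] measurable_component_singleton)
  then have a: "(\<lambda>\<omega>. snd \<omega> p) \<in> borel_measurable ?P" if "p \<in> S" for p
    using that unfolding measurable_cong_sets[OF refl \<nu>] .
  then have "(\<lambda>\<omega>. cnj (snd \<omega> p)) \<in> borel_measurable ?P" if "p \<in> S" for p
    using that
    by (intro measurable_compose[OF a] borel_measurable_continuous_onI continuous_intros)
  then have "(\<lambda>\<omega>. quadform S (M (fst \<omega>)) (snd \<omega>)) \<in> borel_measurable ?P"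
    unfolding quadform_def using a
    by (intro borel_measurable_sum borel_measurable_times measurable_compose[OF measurable_fst M])
  then have "(\<lambda>\<omega>. exp (- quadform S (M (fst \<omega>)) (snd \<omega>))) \<in> borel_measurable ?P"
    by (rule measurable_compose) (intro borel_measurable_continuous_onI continuous_intros)
  then show ?thesis by (simp add: split_def)
qed

lemma integrable_pair_measure_snd:
  fixes g :: "'b \<Rightarrow> 'c::{banach, second_countable_topology}"
  assumes "prob_space H" "sigma_finite_measure P" and g: "integrable P g"
  shows "integrable (H \<Otimes>\<^sub>M P) (\<lambda>(h, a). g a)"
proof -
  interpret H: prob_space H by fact
  interpret P: sigma_finite_measure P by fact
  interpret pair_sigma_finite H P ..
  show ?thesis
  proof (rule Fubini_integrable)
    show "(\<lambda>(h, a). g a) \<in> borel_measurable (H \<Otimes>\<^sub>M P)"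
      using measurable_compose[OF measurable_snd borel_measurable_integrable[OF g]]
      by (simp add: split_def)
  qed (use g in simp_all)
qed

lemma integrable_exp_neg_quadform:
  fixes \<nu> :: "complex measure" and M :: "'w \<Rightarrow> 'p \<Rightarrow> 'p \<Rightarrow> complex"
  assumes S: "finite S" and H: "prob_space H"
    and \<nu>: "sigma_finite_measure \<nu>" "sets \<nu> = sets borel"
    and gaussian: "integrable \<nu> (\<lambda>z. exp (- \<kappa> * (cmod z)\<^sup>2))"
    and M: "\<And>p q. p \<in> S \<Longrightarrow> q \<in> S \<Longrightarrow> (\<lambda>h. M h p q) \<in> borel_measurable H"
    and coercive: "\<And>h. coercive_on \<kappa> S (M h)"
  shows "integrable (H \<Otimes>\<^sub>M PiM S (\<lambda>_. \<nu>)) (\<lambda>(h, a). exp (- quadform S (M h) a))"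
proof (rule Bochner_Integration.integrable_bound)
  let ?g = "\<lambda>a. \<Prod>p\<in>S. exp (- \<kappa> * (cmod (a p))\<^sup>2)"
  interpret product_sigma_finite "\<lambda>_::'p. \<nu>"
    using \<nu>(1) by (rule product_sigma_finite.intro)
  show "integrable (H \<Otimes>\<^sub>M PiM S (\<lambda>_. \<nu>)) (\<lambda>(h, a). ?g a)"
    by (intro integrable_pair_measure_snd H sigma_finite product_integrable_prod S gaussian)
  show "(\<lambda>(h, a). exp (- quadform S (M h) a)) \<in> borel_measurable (H \<Otimes>\<^sub>M PiM S (\<lambda>_. \<nu>))"
    by (rule borel_measurable_exp_neg_quadform[OF \<nu>(2) M])
  have "cmod (exp (- quadform S (M h) a)) \<le> ?g a" for h a
    using coercive[of h] S
    by (simp add: coercive_on_def norm_on_power2 exp_sum[symmetric] sum_negf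
        sum_distrib_left[symmetric])
  then show "AE \<omega> in H \<Otimes>\<^sub>M PiM S (\<lambda>_. \<nu>). norm (case \<omega> of (h, a) \<Rightarrow> exp (- quadform S (M h) a))
      \<le> norm (case \<omega> of (h, a) \<Rightarrow> ?g a)"
    by (auto simp: prod_nonneg)
qed

section \<open>The block matrix\<close>

definition hop :: "nat \<Rightarrow> real \<Rightarrow> ('x::finite) cmat \<Rightarrow> (nat \<Rightarrow> 'x \<Rightarrow> complex)
    \<Rightarrow> nat \<times> 'x \<Rightarrow> nat \<times> 'x \<Rightarrow> complex" where
  "hop n eps A h = (\<lambda>(j, x) (j', x').
     (if j' = Suc j then mexp (mscale (- complex_of_real eps) A) x x'
        * exp (\<i> * complex_of_real (sqrt eps) * h j' x') else 0)
   + (if j = n \<and> j' = 0 \<and> x = x' then 1 else 0))"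

definition transfer :: "real \<Rightarrow> ('x::finite) cmat \<Rightarrow> ('x \<Rightarrow> complex) \<Rightarrow> complex^'x \<Rightarrow> complex^'x" where
  "transfer eps A \<eta> f = to_matrix (mexp (mscale (- complex_of_real eps) A))
     *v (\<chi> x. exp (\<i> * complex_of_real (sqrt eps) * \<eta> x) * f $ x)"

definition slice :: "(nat \<times> 'x \<Rightarrow> complex) \<Rightarrow> nat \<Rightarrow> complex^('x::finite)" where
  "slice a j = (\<chi> x. a (j, x))"

lemma slice_nth [simp]: "slice a j $ x = a (j, x)"
  by (simp add: slice_def)

lemma Kmat_eq_one_minus_hop: "Kmat n eps A h = one_minus (hop n eps A h)"
  by (auto simp: Kmat_def one_minus_def hop_def fun_eq_iff)

lemma finite_XT [simp]: "finite (XT n :: (nat \<times> 'x::finite) set)"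
  by (simp add: XT_def)

lemma mem_XT [simp]: "(j, x) \<in> XT n \<longleftrightarrow> j \<le> n"
  by (simp add: XT_def)

lemma sum_XT: "(\<Sum>p\<in>XT n. g p) = (\<Sum>j\<le>n. \<Sum>x\<in>UNIV. g (j, x))"
  by (simp add: XT_def sum.cartesian_product atLeast0AtMost split_def)

lemma norm_on_XT_power2: "(norm_on (XT n) a)\<^sup>2 = (\<Sum>j\<le>n. (norm (slice a j))\<^sup>2)"
  by (simp add: norm_on_power2 sum_XT norm_vec_def L2_set_def sum_nonneg)

lemma mulv_on_hop_less:
  assumes "j < n"
  shows "mulv_on (XT n) (hop n eps A h) a (j, x) = transfer eps A (h (Suc j)) (slice a (Suc j)) $ x"
proof -
  have "mulv_on (XT n) (hop n eps A h) a (j, x)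
      = (\<Sum>j'\<le>n. if j' = Suc j then transfer eps A (h (Suc j)) (slice a (Suc j)) $ x else 0)"
    unfolding mulv_on_def sum_XT using assms
    by (intro sum.cong refl) (auto simp: hop_def transfer_def mult.assoc)
  with assms show ?thesis by simp
qed

lemma mulv_on_hop_last: "mulv_on (XT n) (hop n eps A h) a (n, x) = a (0, x)"
proof -
  have "mulv_on (XT n) (hop n eps A h) a (n, x) = (\<Sum>j'\<le>n. if j' = 0 then a (0, x) else 0)"
    unfolding mulv_on_def sum_XT
    by (intro sum.cong refl) (auto simp: hop_def if_distrib[of "\<lambda>c. c * _"] cong: if_cong)
  then show ?thesis by simp
qed

lemma Re_quadform_hop:
  "Re (quadform (XT n) (hop n eps A h) a)
    = (\<Sum>j<n. slice a j \<bullet> transfer eps A (h (Suc j)) (slice a (Suc j))) + slice a n \<bullet> slice a 0"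
proof -
  have "Re (quadform (XT n) (hop n eps A h) a)
      = (\<Sum>j\<le>n. \<Sum>x\<in>UNIV. Re (cnj (a (j, x)) * mulv_on (XT n) (hop n eps A h) a (j, x)))"
    by (simp only: quadform_eq_mulv_on sum_XT Re_sum)
  also have "\<dots> = (\<Sum>j<n. slice a j \<bullet> transfer eps A (h (Suc j)) (slice a (Suc j)))
      + slice a n \<bullet> slice a 0"
    unfolding lessThan_Suc_atMost[symmetric] sum.lessThan_Suc
    by (intro arg_cong2[of _ _ _ _ "(+)"] sum.cong refl)
       (simp_all only: mulv_on_hop_less mulv_on_hop_last inner_complex_vec Re_sum slice_nth
         lessThan_iff)
  finally show ?thesis .
qed

lemma norm_transfer_le:
  assumes "hermitian A" "0 \<le> eps" "\<And>x. \<bar>Im (\<eta> x)\<bar> \<le> c"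
  shows "norm (transfer eps A \<eta> f) \<le> exp (sqrt eps * c - eps * e_min A) * norm f"
proof -
  let ?phase = "\<lambda>x. exp (\<i> * complex_of_real (sqrt eps) * \<eta> x)"
  have "norm (?phase x) \<le> exp (sqrt eps * c)" for x
    using assms(2) assms(3)[of x] mult_left_mono[of "- Im (\<eta> x)" c "sqrt eps"] by simp
  then have "norm (\<chi> x. ?phase x * f $ x) \<le> norm (exp (sqrt eps * c) *\<^sub>R f)"
    by (intro norm_le_componentwise_cart) (simp add: norm_mult mult_right_mono del: norm_exp_eq_Re)
  moreover have "norm (transfer eps A \<eta> f) \<le> exp (- eps * e_min A) * norm (\<chi> x. ?phase x * f $ x)"
    unfolding transfer_def by (rule norm_mexp_mult_le[OF assms(1,2)])
  ultimately have "norm (transfer eps A \<eta> f)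
      \<le> exp (- eps * e_min A) * norm (exp (sqrt eps * c) *\<^sub>R f)"
    by (meson exp_ge_zero mult_left_mono order_trans)
  then show ?thesis by (simp add: exp_diff exp_minus field_simps)
qed

lemma cyclic_sum_le:
  fixes t :: "nat \<Rightarrow> real"
  assumes "0 \<le> r" "r \<le> 1" "1 \<le> n"
  shows "r * (\<Sum>j<n. t j * t (Suc j)) + t n * t 0 \<le> (1 + r) / 2 * (\<Sum>j\<le>n. (t j)\<^sup>2)"
proof -
  define total ends where "total = (\<Sum>j\<le>n. (t j)\<^sup>2)" and "ends = ((t n)\<^sup>2 + (t 0)\<^sup>2) / 2"
  have amgm: "x * y \<le> (x\<^sup>2 + y\<^sup>2) / 2" for x y :: real
    using sum_squares_bound[of x y] by simp
  have "(\<Sum>j<n. t j * t (Suc j)) \<le> (\<Sum>j<n. ((t j)\<^sup>2 + (t (Suc j))\<^sup>2) / 2)"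
    by (intro sum_mono amgm)
  also have "\<dots> = ((\<Sum>j<n. (t j)\<^sup>2) + (\<Sum>j<n. (t (Suc j))\<^sup>2)) / 2"
    by (simp add: sum_divide_distrib[symmetric] sum.distrib)
  also have "(\<Sum>j<n. (t j)\<^sup>2) = total - (t n)\<^sup>2"
    by (simp add: total_def lessThan_Suc_atMost[symmetric])
  also have "(\<Sum>j<n. (t (Suc j))\<^sup>2) = total - (t 0)\<^sup>2"
    by (simp add: total_def lessThan_Suc_atMost[symmetric] sum.lessThan_Suc_shift
        del: sum.lessThan_Suc)
  finally have "(\<Sum>j<n. t j * t (Suc j)) \<le> total - ends"
    by (simp add: ends_def field_simps)
  then have "r * (\<Sum>j<n. t j * t (Suc j)) + t n * t 0 \<le> r * (total - ends) + ends"
    using \<open>0 \<le> r\<close> unfolding ends_def by (intro add_mono mult_left_mono amgm)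
  also have "\<dots> = r * total + (1 - r) * ends"
    by (simp add: algebra_simps)
  also have "\<dots> \<le> r * total + (1 - r) * (total / 2)"
  proof (intro add_left_mono mult_left_mono)
    have "(\<Sum>j\<in>{0, n}. (t j)\<^sup>2) \<le> total"
      unfolding total_def by (intro sum_mono2) auto
    then show "ends \<le> total / 2"
      using \<open>1 \<le> n\<close> by (simp add: ends_def)
  qed (use \<open>r \<le> 1\<close> in simp)
  also have "\<dots> = (1 + r) / 2 * total"
    by (simp add: field_simps)
  finally show ?thesis by (simp add: total_def)
qed

lemma coercive_on_Kmat:
  fixes A :: "('x::finite) cmat"
  assumes "0 \<le> r" "r \<le> 1" "1 \<le> n"
    and contraction: "\<And>j f. j \<in> {1..n} \<Longrightarrow> norm (transfer eps A (h j) f) \<le> r * norm f"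
  shows "coercive_on ((1 - r) / 2) (XT n) (Kmat n eps A h)"
  unfolding coercive_on_def
proof
  fix a :: "nat \<times> 'x \<Rightarrow> complex"
  let ?t = "\<lambda>j. norm (slice a j)"
  have "slice a j \<bullet> transfer eps A (h (Suc j)) (slice a (Suc j)) \<le> r * (?t j * ?t (Suc j))"
    if "j < n" for j
  proof -
    have "slice a j \<bullet> transfer eps A (h (Suc j)) (slice a (Suc j)) \<le> ?t j * (r * ?t (Suc j))"
      using that by (intro order_trans[OF norm_cauchy_schwarz] mult_left_mono contraction) auto
    then show ?thesis by (simp add: mult.left_commute)
  qed
  then have "Re (quadform (XT n) (hop n eps A h) a) \<le> (\<Sum>j<n. r * (?t j * ?t (Suc j))) + ?t n * ?t 0"
    unfolding Re_quadform_hop by (intro add_mono sum_mono norm_cauchy_schwarz) auto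
  also have "\<dots> \<le> (1 + r) / 2 * (norm_on (XT n) a)\<^sup>2"
    unfolding norm_on_XT_power2 sum_distrib_left[symmetric] by (rule cyclic_sum_le[OF assms(1-3)])
  finally show "(1 - r) / 2 * (norm_on (XT n) a)\<^sup>2 \<le> Re (quadform (XT n) (Kmat n eps A h) a)"
    unfolding Kmat_eq_one_minus_hop Re_quadform_one_minus[OF finite_XT]
    by (simp add: diff_divide_distrib add_divide_distrib left_diff_distrib distrib_right)
qed

abbreviation (input) of_real_field :: "(nat \<Rightarrow> 'x \<Rightarrow> real) \<Rightarrow> nat \<Rightarrow> 'x \<Rightarrow> complex" where
  "of_real_field h \<equiv> \<lambda>j x. complex_of_real (h j x)"

lemma borel_measurable_Kmat:
  assumes M: "sets M = sets (PiM UNIV (\<lambda>_. borel))" and "p \<in> XT n" "q \<in> XT n"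
  shows "(\<lambda>h. Kmat n eps A (of_real_field h) p q) \<in> borel_measurable (PiM {1..n} (\<lambda>_. M))"
proof -
  obtain j x j' x' where pq: "p = (j, x)" "q = (j', x')" by (cases p; cases q)
  show ?thesis
  proof (cases "j' = j + 1")
    case True
    have "(\<lambda>\<omega>. \<omega> x') \<in> borel_measurable M"
      unfolding measurable_cong_sets[OF M refl] by simp
    then have "(\<lambda>h. h j' x') \<in> borel_measurable (PiM {1..n} (\<lambda>_. M))"
      using True assms(3) pq
      by (intro measurable_compose[OF measurable_component_singleton[of j']]) auto
    then have "(\<lambda>h. exp (\<i> * complex_of_real (sqrt eps) * complex_of_real (h j' x')))
        \<in> borel_measurable (PiM {1..n} (\<lambda>_. M))"
      by (rule measurable_compose) (intro borel_measurable_continuous_onI continuous_intros)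
    then show ?thesis
      unfolding pq Kmat_def prod.case if_P[OF True]
      by (intro borel_measurable_diff borel_measurable_times borel_measurable_const)
  qed (simp add: pq Kmat_def)
qed

lemma continuous_on_Kmat:
  fixes A :: "('x::finite) cmat"
  shows "continuous_on D (\<lambda>h. Kmat n eps A h p q)"
proof -
  obtain j x j' x' where pq: "p = (j, x)" "q = (j', x')" by (cases p; cases q)
  have "continuous_on D (\<lambda>h :: nat \<Rightarrow> 'x \<Rightarrow> complex. h j' x')"
    by (rule continuous_on_product_then_coordinatewise[OF
          continuous_on_product_then_coordinatewise[OF continuous_on_id]])
  then show ?thesis
    unfolding pq Kmat_def prod.case
    by (cases "j' = j + 1") (auto intro!: continuous_intros)
qed

lemma holomorphic_on_Kmat:
  assumes "\<And>j x. (\<lambda>z. h z j x) holomorphic_on Z"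
  shows "(\<lambda>z. Kmat n eps A (h z) p q) holomorphic_on Z"
proof -
  obtain j x j' x' where pq: "p = (j, x)" "q = (j', x')" by (cases p; cases q)
  show ?thesis
    unfolding pq Kmat_def prod.case
    by (cases "j' = j + 1") (auto intro!: holomorphic_intros assms)
qed

lemma analytic_several_Kmat:
  fixes A :: "('x::finite) cmat"
  shows "analytic_several I D (\<lambda>h. Kmat n eps A h p q)"
proof -
  have "(\<lambda>z. (h(j := (h j)(x := z))) i y) holomorphic_on Z"
    for h :: "nat \<Rightarrow> 'x \<Rightarrow> complex" and i j x y Z
    by (cases "i = j"; cases "y = x") (simp_all add: holomorphic_on_ident)
  then show ?thesis
    unfolding analytic_several_def by (auto intro!: continuous_on_Kmat holomorphic_on_Kmat)
qed

lemma
  assumes "generates_stochastic A" "0 \<le> eps"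
  shows hop_zero_real:
      "complex_of_real (Re (hop n eps A (\<lambda>_ _. 0) p q)) = hop n eps A (\<lambda>_ _. 0) p q"
    and cmod_hop_le_hop_zero:
      "cmod (hop n eps A (of_real_field h) p q) \<le> Re (hop n eps A (\<lambda>_ _. 0) p q)"
proof -
  let ?E = "mexp (mscale (- complex_of_real eps) A)"
  have "Im (?E x y) = 0" "cmod (?E x y) = Re (?E x y)" for x y
    using assms unfolding generates_stochastic_def by (simp_all add: complex_is_Real_iff cmod_eq_Re)
  then show "complex_of_real (Re (hop n eps A (\<lambda>_ _. 0) p q)) = hop n eps A (\<lambda>_ _. 0) p q"
    "cmod (hop n eps A (of_real_field h) p q) \<le> Re (hop n eps A (\<lambda>_ _. 0) p q)"
    by (cases p; cases q; simp add: hop_def norm_mult complex_eq_iff)+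
qed

section \<open>The grand-canonical covariance\<close>

definition strip :: "nat \<Rightarrow> real \<Rightarrow> (nat \<Rightarrow> 'x \<Rightarrow> complex) set" where
  "strip n b = {h. \<forall>j\<in>{1..n}. \<forall>x. \<bar>Im (h j x)\<bar> < b}"

lemma strip_closed_substrip:
  fixes h :: "nat \<Rightarrow> 'x::finite \<Rightarrow> complex"
  assumes "h \<in> strip n b" "0 < b"
  obtains c where "c < b" "\<And>j x. j \<in> {1..n} \<Longrightarrow> \<bar>Im (h j x)\<bar> \<le> c"
proof
  let ?B = "insert 0 ((\<lambda>(j, x). \<bar>Im (h j x)\<bar>) ` ({1..n} \<times> UNIV))"
  show "Max ?B < b"
    using assms by (subst Max_less_iff) (auto simp: strip_def)
  show "\<bar>Im (h j x)\<bar> \<le> Max ?B" if "j \<in> {1..n}" for j x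
    using that by (intro Max_ge) (auto simp: image_iff)
qed

locale thermal_lattice =
  fixes A :: "('x::finite) cmat" and n :: nat and eps :: real
  assumes pos_def_A: "pos_def A" and n_pos: "1 \<le> n" and eps_pos: "0 < eps"
begin

abbreviation K :: "(nat \<Rightarrow> 'x \<Rightarrow> complex) \<Rightarrow> nat \<times> 'x \<Rightarrow> nat \<times> 'x \<Rightarrow> complex" where
  "K \<equiv> Kmat n eps A"

abbreviation G :: "(nat \<Rightarrow> 'x \<Rightarrow> complex) \<Rightarrow> nat \<times> 'x \<Rightarrow> nat \<times> 'x \<Rightarrow> complex" where
  "G \<equiv> Gcov n eps A"

abbreviation width :: real where
  "width \<equiv> sqrt eps * e_min A"

definition coercivity :: "real \<Rightarrow> real" where
  "coercivity c = (1 - exp (sqrt eps * c - eps * e_min A)) / 2"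

lemma width_pos: "0 < width"
  using e_min_pos[OF pos_def_A] eps_pos by simp

lemma coercivity_pos:
  assumes "c < width"
  shows "0 < coercivity c"
proof -
  have "sqrt eps * c < sqrt eps * width"
    using assms eps_pos by simp
  also have "\<dots> = eps * e_min A"
    using eps_pos by (simp flip: mult.assoc)
  finally show ?thesis by (simp add: coercivity_def)
qed

lemma coercive_on_K:
  assumes "c < width" and "\<And>j x. j \<in> {1..n} \<Longrightarrow> \<bar>Im (h j x)\<bar> \<le> c"
  shows "coercive_on (coercivity c) (XT n) (K h)"
proof -
  have "norm (transfer eps A (h j) f) \<le> exp (sqrt eps * c - eps * e_min A) * norm f"
    if "j \<in> {1..n}" for j f
    using pos_def_A eps_pos assms(2)[OF that] by (intro norm_transfer_le) (auto simp: pos_def_def)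
  then show ?thesis
    unfolding coercivity_def using coercivity_pos[OF assms(1)] n_pos
    by (intro coercive_on_Kmat) (auto simp: coercivity_def)
qed

lemma coercive_on_K_strip:
  assumes "h \<in> strip n width"
  shows "\<exists>\<kappa>>0. coercive_on \<kappa> (XT n) (K h)"
  using strip_closed_substrip[OF assms width_pos] coercive_on_K coercivity_pos by metis

lemma coercive_on_K_real: "coercive_on (coercivity 0) (XT n) (K (of_real_field h))"
  by (rule coercive_on_K[OF width_pos]) simp

lemma invertible_on_K:
  assumes "h \<in> strip n width"
  shows "invertible_on (XT n) (K h)"
  using coercive_on_K_strip[OF assms] inverse_on_inv_on[OF finite_XT]
  unfolding invertible_on_def by blast

lemma of_real_field_in_strip: "of_real_field h \<in> strip n width"
  using width_pos by (simp add: strip_def)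

lemma opnorm_on_G_le: "opnorm_on (XT n) (G (of_real_field h)) \<le> 1 / coercivity 0"
  unfolding Gcov_def
  by (rule opnorm_on_inv_on_le[OF finite_XT coercive_on_K_real coercivity_pos[OF width_pos]])

lemma analytic_several_G:
  assumes "p \<in> XT n" "q \<in> XT n"
  shows "analytic_several I (strip n width) (\<lambda>h. G h p q)"
  unfolding Gcov_def
  by (rule analytic_several_inv_on[OF finite_XT assms coercive_on_K_strip analytic_several_Kmat])

lemma
  assumes "generates_stochastic A" "p \<in> XT n" "q \<in> XT n"
  shows G_zero_real: "G (\<lambda>_ _. 0) p q \<in> \<real>"
    and cmod_G_le_G_zero: "cmod (G (of_real_field h) p q) \<le> Re (G (\<lambda>_ _. 0) p q)"
proof -
  let ?R = "\<lambda>p q. Re (hop n eps A (\<lambda>_ _. 0) p q)"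
  have eps_nonneg: "0 \<le> eps" using eps_pos by simp
  have K_zero_eq: "K (\<lambda>_ _. 0) = one_minus (\<lambda>p q. complex_of_real (?R p q))"
    by (simp add: Kmat_eq_one_minus_hop hop_zero_real[OF assms(1) eps_nonneg])
  have coercive_zero: "coercive_on (coercivity 0) (XT n) (K (\<lambda>_ _. 0))"
    using coercive_on_K_real[of "\<lambda>_ _. 0"] by simp
  have dominated: "cmod (hop n eps A (of_real_field h) p q) \<le> ?R p q" for h p q
    by (rule cmod_hop_le_hop_zero[OF assms(1) eps_nonneg])
  then have nonneg: "0 \<le> ?R p q" for p q
    using norm_ge_zero order_trans by blast
  show "G (\<lambda>_ _. 0) p q \<in> \<real>"
    unfolding Gcov_def K_zero_eq
    by (rule inv_on_one_minus_real[OF finite_XT coercive_zero[unfolded K_zero_eq]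
          coercivity_pos[OF width_pos] nonneg assms(2,3)])
  show "cmod (G (of_real_field h) p q) \<le> Re (G (\<lambda>_ _. 0) p q)"
    unfolding Gcov_def K_zero_eq Kmat_eq_one_minus_hop[of n eps A "of_real_field h"]
    by (rule cmod_inv_on_one_minus_le[OF finite_XT coercive_on_K_real[unfolded Kmat_eq_one_minus_hop]
          coercivity_pos[OF width_pos] coercive_zero[unfolded K_zero_eq]
          coercivity_pos[OF width_pos] dominated assms(2,3)])
qed

lemma integrable_exp_neg_quadform_K:
  fixes M :: "('x \<Rightarrow> real) measure"
  assumes "prob_space M" "sets M = sets (PiM UNIV (\<lambda>_. borel))"
  shows "integrable (PiM {1..n} (\<lambda>_. M) \<Otimes>\<^sub>M Da n)
    (\<lambda>(h, a). exp (- quadform (XT n) (K (of_real_field h)) a))"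
  unfolding Da_def
proof (rule integrable_exp_neg_quadform[where \<kappa> = "coercivity 0"])
  let ?\<nu> = "density (lborel :: complex measure) (\<lambda>_. ennreal (1 / pi))"
  show "prob_space (PiM {1..n} (\<lambda>_. M))"
    using assms(1) by (rule prob_space_PiM)
  show "sigma_finite_measure ?\<nu>"
    by (subst sigma_finite_measure.sigma_finite_iff_density_finite[OF sigma_finite_lborel]) auto
  show "integrable ?\<nu> (\<lambda>z. exp (- coercivity 0 * (cmod z)\<^sup>2))"
    using integrable_exp_neg_norm_power2[where 'a = complex, OF coercivity_pos[OF width_pos]]
    by (subst integrable_density) auto
  show "(\<lambda>h. K (of_real_field h) p q) \<in> borel_measurable (PiM {1..n} (\<lambda>_. M))"
    if "p \<in> XT n" "q \<in> XT n" for p q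
    using that by (rule borel_measurable_Kmat[OF assms(2)])
qed (simp_all add: coercive_on_K_real)

end

theorem theorem8p1:
  fixes E :: "('x::finite) cmat" and v :: "'x \<Rightarrow> 'x \<Rightarrow> real"
    and mu \<beta> :: real and n\<tau> :: nat and mu_v :: "('x \<Rightarrow> real) measure"
  assumes E_herm: "hermitian E"
    and v_sym: "\<forall>x y. v x y = v y x"
    and v_nonneg: "\<forall>\<xi>::'x \<Rightarrow> real. 0 \<le> (\<Sum>x\<in>UNIV. \<Sum>y\<in>UNIV. \<xi> x * v x y * \<xi> y)"
    and beta_pos: "\<beta> > 0"
    and ntau_pos: "n\<tau> \<ge> 1"
    and gauss: "centered_gaussian v mu_v"
    and Emu_pos: "pos_def (Emu E mu)"
  shows
    "integrable (PiM {1..n\<tau>} (\<lambda>_. mu_v) \<Otimes>\<^sub>M Da n\<tau>)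
       (\<lambda>(h, a). exp (- quadform (XT n\<tau>)
            (Kmat n\<tau> (\<beta> / real n\<tau>) (Emu E mu) (\<lambda>j x. complex_of_real (h j x))) a))
   \<and> (\<forall>h::nat \<Rightarrow> 'x \<Rightarrow> real.
        invertible_on (XT n\<tau>) (Kmat n\<tau> (\<beta> / real n\<tau>) (Emu E mu) (\<lambda>j x. complex_of_real (h j x))))
   \<and> (\<exists>C. \<forall>h::nat \<Rightarrow> 'x \<Rightarrow> real.
        opnorm_on (XT n\<tau>) (Gcov n\<tau> (\<beta> / real n\<tau>) (Emu E mu) (\<lambda>j x. complex_of_real (h j x))) \<le> C)
   \<and> (let D = {h :: nat \<Rightarrow> 'x \<Rightarrow> complex. \<forall>j\<in>{1..n\<tau>}. \<forall>x.
                 \<bar>Im (h j x)\<bar> < sqrt (\<beta> / real n\<tau>) * e_min (Emu E mu)}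
      in (\<forall>h\<in>D. invertible_on (XT n\<tau>) (Kmat n\<tau> (\<beta> / real n\<tau>) (Emu E mu) h))
         \<and> (\<forall>p\<in>XT n\<tau>. \<forall>q\<in>XT n\<tau>.
              analytic_several ({1..n\<tau>} \<times> UNIV) D (\<lambda>h. Gcov n\<tau> (\<beta> / real n\<tau>) (Emu E mu) h p q)))
   \<and> (generates_stochastic (Emu E mu) \<longrightarrow>
        (\<forall>h::nat \<Rightarrow> 'x \<Rightarrow> real. \<forall>j j' x x'. j \<le> j' \<and> j' \<le> n\<tau> \<longrightarrow>
           Gcov n\<tau> (\<beta> / real n\<tau>) (Emu E mu) (\<lambda>_ _. 0) (j, x) (j', x') \<in> \<real> \<and>
           cmod (Gcov n\<tau> (\<beta> / real n\<tau>) (Emu E mu) (\<lambda>j x. complex_of_real (h j x)) (j, x) (j', x'))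
             \<le> Re (Gcov n\<tau> (\<beta> / real n\<tau>) (Emu E mu) (\<lambda>_ _. 0) (j, x) (j', x'))))"
proof -
  interpret thermal_lattice "Emu E mu" n\<tau> "\<beta> / real n\<tau>"
    using Emu_pos beta_pos ntau_pos by unfold_locales auto
  have "prob_space mu_v" "sets mu_v = sets (PiM UNIV (\<lambda>_. borel))"
    using gauss by (auto simp: centered_gaussian_def)
  note integrable = integrable_exp_neg_quadform_K[OF this]
  show ?thesis
    unfolding Let_def strip_def[symmetric]
    using integrable invertible_on_K[OF of_real_field_in_strip] opnorm_on_G_le invertible_on_K
      analytic_several_G G_zero_real cmod_G_le_G_zero
    by (intro conjI allI impI ballI exI[of _ "1 / coercivity 0"]) auto
qed

end
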